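(* Let $X$ be an $\aleph_0$-space, $Y$ be an $\aleph$-space and $\mathcal K$ be a family of compact subsets of $X$ with union $\bigcup\mathcal K$ dense in $X$. A subspace $\mathcal F\subset C_{\mathcal K}(X,Y)$ is $k^*$-metrizable if the evaluation operator $e:\mathcal F\times X\to Y$, $e:(f,x)\mapsto f(x)$, is sequentially continuous.
   Context: All topological spaces are Hausdorff; "map" means continuous function. A subset is precompact if its closure is compact. A map $f:M\to X$ is subproper if there is $Z\subset M$ with $f(Z)=X$ such that $Z\cap f^{-1}(K)$ is precompact in $M$ for every precompact $K\subset X$. A space is $k^*$-metrizable if it is the image of a metrizable space under a subproper map. A $k$-network for $X$ is a family $\mathcal N$ of subsets such that for every open $U$ and compact $K\subset U$ there is a finite $\mathcal F\subset\mathcal N$ with $K\subset\bigcup\mathcal F\subset U$. An $\aleph_0$-space is a regular space with a countable $k$-network; an $\aleph$-space is a regular space with a $\sigma$-locally-finite $k$-network (a countable union of locally finite families). $C_{\mathcal K}(X,Y)$ is the set $C(X,Y)$ of all continuous functions from $X$ to $Y$ with the topology generated by the sub-base of sets $[F,U]=\{f\in C(X,Y):f(F)\subset U\}$, where $F$ is a closed subset of some $K\in\mathcal K$ and $U\subset Y$ is open. A function is sequentially continuous if it sends convergent sequences to convergent sequences. *)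

theory Defs
  imports "HOL-Analysis.Analysis"
begin

text \<open>
  All topological spaces are Hausdorff by convention. As neither \<^const>\<open>regular_space\<close> nor the type
  of topologies includes a separation axiom, the classes of spaces defined below ask for it
  explicitly.
\<close>

section \<open>Subproper maps and \<open>k\<^sup>*\<close>-metrizable spaces\<close>

definition precompact_in :: "'a topology \<Rightarrow> 'a set \<Rightarrow> bool"
  where "precompact_in X S \<longleftrightarrow> S \<subseteq> topspace X \<and> compactin X (X closure_of S)"

definition subproper_map :: "'a topology \<Rightarrow> 'b topology \<Rightarrow> ('a \<Rightarrow> 'b) \<Rightarrow> bool"
  where "subproper_map M X f \<longleftrightarrow>
    continuous_map M X f \<and>
    (\<exists>Z. Z \<subseteq> topspace M \<and> f ` Z = topspace X \<and>
         (\<forall>K. precompact_in X K \<longrightarrow> precompact_in M (Z \<inter> f -` K)))"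

text \<open>
  HOL cannot quantify existentially over the type of points of the metrizable space \<open>M\<close>. Fixing it
  to be \<^typ>\<open>nat \<Rightarrow> 'a\<close> is no restriction: by \<open>kstar_metrizable_spaceI\<close> below, a metrizable space \<open>M\<close> on
  an arbitrary type will do, because \<open>Z\<close> may be shrunk to meet each fibre in one point and \<open>M\<close> to the
  closure of \<open>Z\<close>, whose points are limits of sequences in \<open>Z\<close>. Surjectivity of \<open>f\<close> is part of
  \<^const>\<open>subproper_map\<close>.
\<close>

definition kstar_metrizable_space :: "'a topology \<Rightarrow> bool"
  where "kstar_metrizable_space X \<longleftrightarrow>
    Hausdorff_space X \<and>
    (\<exists>(M :: (nat \<Rightarrow> 'a) topology) f. metrizable_space M \<and> subproper_map M X f)"

lemma kstar_metrizable_spaceI: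
  fixes M :: "'m topology" and X :: "'a topology"
  assumes X: "Hausdorff_space X" and M: "metrizable_space M" and f: "subproper_map M X f"
  shows "kstar_metrizable_space X"
proof -
  obtain Z where contf: "continuous_map M X f" and Z: "Z \<subseteq> topspace M" "f ` Z = topspace X"
    and pre: "\<And>K. precompact_in X K \<Longrightarrow> precompact_in M (Z \<inter> f -` K)"
    using f unfolding subproper_map_def by blast
  have "\<forall>x\<in>topspace X. \<exists>z. z \<in> Z \<and> f z = x"
    using Z(2) by (metis imageE)
  then obtain z where z: "\<And>x. x \<in> topspace X \<Longrightarrow> z x \<in> Z \<and> f (z x) = x"
    by metis
  define W where "W = z ` topspace X"
  have WZ: "W \<subseteq> Z" and fW: "f ` W = topspace X"
    using z by (auto simp: W_def image_image)
  define C where "C = M closure_of W"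
  have CM: "C \<subseteq> topspace M" and closedC: "closedin M C"
    unfolding C_def by (rule closure_of_subset_topspace, rule closedin_closure_of)
  have WC: "W \<subseteq> C"
    unfolding C_def using WZ Z(1) by (intro closure_of_subset) blast
  have H: "Hausdorff_space M"
    using M metrizable_imp_Hausdorff_space by blast
  have "\<exists>s. limitin M (z \<circ> s) p sequentially" if p: "p \<in> C" for p
  proof -
    obtain S d where Sd: "Metric_space S d" and Meq: "M = Metric_space.mtopology S d"
      using M unfolding metrizable_space_def by blast
    then obtain r where r: "range r \<subseteq> W" "limitin M r p sequentially"
      using p Metric_space.closure_of_sequentially[OF Sd, of W] unfolding C_def by auto
    have "\<forall>n. \<exists>x. r n = z x"
      using r(1) by (auto simp: W_def)
    then obtain s where "\<And>n. r n = z (s n)"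
      by metis
    then have "r = z \<circ> s" by auto
    with r show ?thesis by blast
  qed
  then obtain \<sigma> where \<sigma>: "\<And>p. p \<in> C \<Longrightarrow> limitin M (z \<circ> \<sigma> p) p sequentially"
    by metis
  have inj: "inj_on \<sigma> C"
    by (rule inj_onI) (metis \<sigma> H limitin_Hausdorff_unique trivial_limit_sequentially)
  define g where "g = inv_into C \<sigma>"
  have g\<sigma>: "\<And>p. p \<in> C \<Longrightarrow> g (\<sigma> p) = p"
    using inj by (simp add: g_def)
  have gimg: "g ` (\<sigma> ` A \<inter> B) = {p \<in> A. \<sigma> p \<in> B}" if "A \<subseteq> C" for A B
  proof (intro equalityI subsetI)
    fix p assume "p \<in> g ` (\<sigma> ` A \<inter> B)"
    then obtain a where a: "a \<in> A" "\<sigma> a \<in> B" "p = g (\<sigma> a)" by blast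
    then show "p \<in> {p \<in> A. \<sigma> p \<in> B}" using that g\<sigma>[of a] by auto
  next
    fix p assume p: "p \<in> {p \<in> A. \<sigma> p \<in> B}"
    then have "p = g (\<sigma> p)" using that g\<sigma>[of p] by auto
    then show "p \<in> g ` (\<sigma> ` A \<inter> B)" using p by blast
  qed
  define N where "N = subtopology M C"
  have tN: "topspace N = C"
    using CM by (auto simp: N_def)
  define M' where "M' = pullback_topology (\<sigma> ` C) g N"
  have tM': "topspace M' = \<sigma> ` C"
    using g\<sigma> by (auto simp: M'_def topspace_pullback_topology tN)
  have gmap: "homeomorphic_map M' N g"
  proof (rule bijective_open_imp_homeomorphic_map)
    show "continuous_map M' N g"
      unfolding M'_def using continuous_map_pullback[of N N id "\<sigma> ` C" g] by simp
    show "open_map M' N g"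
      unfolding open_map_def M'_def openin_pullback_topology
    proof (intro allI impI)
      fix U assume "\<exists>T. openin N T \<and> U = g -` T \<inter> \<sigma> ` C"
      then obtain T where T: "openin N T" "U = g -` T \<inter> \<sigma> ` C" by blast
      have "T \<subseteq> C" using T(1) openin_subset tN by blast
      then have "g ` U = T"
        using T(2) g\<sigma> gimg[of C "g -` T"] by (auto simp: Int_commute)
      then show "openin N (g ` U)" using T(1) by simp
    qed
    show "g ` topspace M' = topspace N"
      using g\<sigma> by (simp add: tM' tN image_image)
    show "inj_on g (topspace M')"
      unfolding tM' by (rule inj_on_inverseI[where g = \<sigma>]) (auto simp: g\<sigma>)
  qed
  have metM': "metrizable_space M'"
    using homeomorphic_metrizable_space[of M' N] gmap metrizable_space_subtopology[OF M]
    by (auto simp: N_def homeomorphic_space)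
  have "subproper_map M' X (f \<circ> g)"
    unfolding subproper_map_def
  proof (intro conjI exI[of _ "\<sigma> ` W"] allI impI)
    show "continuous_map M' X (f \<circ> g)"
      using continuous_map_compose[of M' N g X f] homeomorphic_imp_continuous_map[OF gmap]
        continuous_map_from_subtopology[OF contf] by (simp add: N_def)
    show "\<sigma> ` W \<subseteq> topspace M'"
      using WC tM' by blast
    have "g ` \<sigma> ` W = W"
      using gimg[OF WC, of UNIV] by simp
    then show "(f \<circ> g) ` \<sigma> ` W = topspace X"
      using fW by (metis image_comp)
    fix K assume K: "precompact_in X K"
    define S where "S = W \<inter> f -` K"
    have "precompact_in M (Z \<inter> f -` K)"
      using pre K by blast
    moreover have "M closure_of S \<subseteq> M closure_of (Z \<inter> f -` K)"
      using WZ by (intro closure_of_mono) (auto simp: S_def)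
    ultimately have cS: "compactin M (M closure_of S)"
      unfolding precompact_in_def using closed_compactin[OF _ _ closedin_closure_of] by metis
    have SC: "S \<subseteq> C" using WC by (auto simp: S_def)
    have "M closure_of S \<subseteq> C"
      by (rule closure_of_minimal[OF SC closedC])
    then have "N closure_of S = M closure_of S"
      using SC by (auto simp: N_def closure_of_subtopology Int_absorb1)
    then have cN: "compactin N (N closure_of S)"
      using cS \<open>M closure_of S \<subseteq> C\<close> by (simp add: N_def compactin_subtopology)
    define T where "T = \<sigma> ` W \<inter> (f \<circ> g) -` K"
    have gT: "g ` T = S"
      unfolding T_def S_def gimg[OF WC] using g\<sigma> WC by auto
    have TM: "T \<subseteq> topspace M'"
      using WC tM' by (auto simp: T_def)
    have "g ` (M' closure_of T) = N closure_of S"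
      using homeomorphic_map_closure_of[OF gmap TM] gT by simp
    then have "compactin M' (M' closure_of T)"
      using homeomorphic_map_compactness[OF gmap, of "M' closure_of T"] cN
      by (simp add: closure_of_subset_topspace)
    then show "precompact_in M' (\<sigma> ` W \<inter> (f \<circ> g) -` K)"
      using TM by (simp add: precompact_in_def T_def)
  qed
  with metM' X show ?thesis
    unfolding kstar_metrizable_space_def by blast
qed

section \<open>\<open>k\<close>-networks\<close>

definition k_network :: "'a topology \<Rightarrow> 'a set set \<Rightarrow> bool"
  where "k_network X \<N> \<longleftrightarrow>
    \<N> \<subseteq> Pow (topspace X) \<and>
    (\<forall>U K. openin X U \<and> compactin X K \<and> K \<subseteq> U \<longrightarrow>
       (\<exists>\<F>. finite \<F> \<and> \<F> \<subseteq> \<N> \<and> K \<subseteq> \<Union>\<F> \<and> \<Union>\<F> \<subseteq> U))"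

definition sigma_locally_finite_in :: "'a topology \<Rightarrow> 'a set set \<Rightarrow> bool"
  where "sigma_locally_finite_in X \<N> \<longleftrightarrow>
    (\<exists>\<A> :: nat \<Rightarrow> 'a set set. (\<forall>n. locally_finite_in X (\<A> n)) \<and> \<N> = (\<Union>n. \<A> n))"

definition aleph0_space :: "'a topology \<Rightarrow> bool"
  where "aleph0_space X \<longleftrightarrow>
    Hausdorff_space X \<and> regular_space X \<and> (\<exists>\<N>. countable \<N> \<and> k_network X \<N>)"

definition aleph_space :: "'a topology \<Rightarrow> bool"
  where "aleph_space X \<longleftrightarrow>
    Hausdorff_space X \<and> regular_space X \<and> (\<exists>\<N>. sigma_locally_finite_in X \<N> \<and> k_network X \<N>)"

section \<open>Function spaces\<close>

text \<open>
  Functions that agree on \<open>topspace X\<close> have to be identified, so the elements of \<open>C(X,Y)\<close> are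
  normalised to be \<^const>\<open>undefined\<close> outside \<open>topspace X\<close>.
\<close>

definition cont_funs :: "'a topology \<Rightarrow> 'b topology \<Rightarrow> ('a \<Rightarrow> 'b) set"
  where "cont_funs X Y = {f \<in> extensional (topspace X). continuous_map X Y f}"

text \<open>
  The operator \<open>relative_to\<close> makes \<open>C(X,Y)\<close> itself (the empty intersection) a basic open set.
\<close>

definition C_topology :: "'a set set \<Rightarrow> 'a topology \<Rightarrow> 'b topology \<Rightarrow> ('a \<Rightarrow> 'b) topology"
  where "C_topology \<K> X Y =
    topology (arbitrary union_of
      (finite intersection_of
        (\<lambda>S. \<exists>K F U. K \<in> \<K> \<and> closedin (subtopology X K) F \<and> openin Y U \<and>
                     S = {f \<in> cont_funs X Y. f ` F \<subseteq> U})
       relative_to cont_funs X Y))"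

lemma topspace_C_topology [simp]: "topspace (C_topology \<K> X Y) = cont_funs X Y"
  unfolding C_topology_def by (rule topspace_subbase)

definition sequentially_continuous_map :: "'a topology \<Rightarrow> 'b topology \<Rightarrow> ('a \<Rightarrow> 'b) \<Rightarrow> bool"
  where "sequentially_continuous_map X Y f \<longleftrightarrow>
    f \<in> topspace X \<rightarrow> topspace Y \<and>
    (\<forall>s. range s \<subseteq> topspace X \<and> (\<exists>l. limitin X s l sequentially) \<longrightarrow>
         (\<exists>m. limitin Y (f \<circ> s) m sequentially))"

end

theory Submission
  imports Defs "HOL-Library.Diagonal_Subsequence"
begin

text \<open>
  A regular Hausdorff space \<open>T\<close> is shown to be \<open>k\<^sup>*\<close>-metrizable by reading off countably many
  discrete data \<open>b\<^sub>0 f, b\<^sub>1 f, \<dots>\<close> from every point \<open>f\<close>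
  (\<open>kstar_metrizable_spaceI_discrete_data\<close>). The metrizable space consists of those sequences of data
  in a countable product of discrete spaces that are limits of the data of a convergent sequence of
  \<open>T\<close>, and the subproper map sends such a sequence of data to the limit. Two properties make this
  work: on a compact set every \<open>b\<^sub>i\<close> takes finitely many values, so that the data of a compact set lie
  in a compact box; and if \<open>g\<^sub>k \<longlonglongrightarrow> l\<close> and the data of \<open>f\<^sub>k\<close> and \<open>g\<^sub>k\<close> eventually agree at every index,
  then \<open>f\<^sub>k \<longlonglongrightarrow> l\<close>, which makes the map well defined and continuous. Compact sets must moreover
  be sequentially compact, so that limits of data coming from a compact set do belong to the
  metrizable space.

  For a function space the data of \<open>f\<close> are the sets \<open>{E \<in> \<E>\<^sub>n. f ` N \<subseteq> E}\<close>, where \<open>N\<close> runs through a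
  countable family built from a countable \<open>k\<close>-network of \<open>X\<close> and \<open>\<E>\<^sub>0, \<E>\<^sub>1, \<dots>\<close> are locally finite
  families of subsets of \<open>Y\<close>. They take finitely many values on a compact set of functions because
  evaluation at a point of \<open>N\<close> maps it to a sequentially compact set. For the convergence property
  it is not enough that the \<open>\<E>\<^sub>n\<close> form a \<open>k\<close>-network: several members may be needed to cover a
  convergent sequence with its limit, and \<open>f ` N\<close> may lie in no single one. The \<open>k\<close>-network of \<open>Y\<close> is
  therefore first turned into a \<open>\<sigma>\<close>-locally finite \<open>cs\<close>-network, in which a single member inside a given
  neighbourhood of the limit contains a tail of the sequence (\<open>aleph_space_cs_networks\<close>). Sequential
  continuity of the evaluation then yields, for \<open>g\<^sub>k \<longlonglongrightarrow> l\<close>, \<open>x\<^sub>k \<longlonglongrightarrow> a\<close> and \<open>l a\<close> in an open set \<open>U\<close>, some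
  \<open>N\<close> containing almost all \<open>x\<^sub>k\<close> and some \<open>E \<subseteq> U\<close> with \<open>g\<^sub>k ` N \<subseteq> E\<close> infinitely often
  (\<open>evaluation_captured_by_networks\<close>); functions \<open>f\<^sub>k\<close> with the same data then satisfy \<open>f\<^sub>k x\<^sub>k \<in> U\<close>
  infinitely often, which excludes the failure of \<open>f\<^sub>k \<longlonglongrightarrow> l\<close>.

  Density of \<open>\<Union>\<K>\<close> provides countably many points \<open>d \<in> \<Union>\<K>\<close> whose evaluations are continuous
  and separate the functions. This gives the Hausdorff property and, combined with finitely valued
  data that separate the points of compact subsets of \<open>Y\<close>, the sequential compactness of compact
  sets of functions.
\<close>

section \<open>Sequential compactness from finitely valued data\<close>

definition seq_compactin :: "'a topology \<Rightarrow> 'a set \<Rightarrow> bool"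
  where "seq_compactin T C \<longleftrightarrow> C \<subseteq> topspace T \<and>
    (\<forall>r :: nat \<Rightarrow> 'a. range r \<subseteq> C \<longrightarrow> (\<exists>s l. strict_mono s \<and> l \<in> C \<and> limitin T (r \<circ> s) l sequentially))"

lemma seq_compactinE:
  assumes "seq_compactin T C" "range r \<subseteq> C"
  obtains s l where "strict_mono (s :: nat \<Rightarrow> nat)" "l \<in> C" "limitin T (r \<circ> s) l sequentially"
  using assms unfolding seq_compactin_def by metis

lemma compactin_imp_cluster_point:
  fixes r :: "nat \<Rightarrow> 'a"
  assumes C: "compactin T C" and r: "range r \<subseteq> C"
  obtains p where "p \<in> C" "\<And>U. openin T U \<Longrightarrow> p \<in> U \<Longrightarrow> \<exists>\<^sub>F k in sequentially. r k \<in> U"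
proof (rule ccontr)
  assume "\<not> thesis"
  then have "\<forall>p\<in>C. \<exists>U. openin T U \<and> p \<in> U \<and> (\<forall>\<^sub>F k in sequentially. r k \<notin> U)"
    using that unfolding frequently_def by blast
  then obtain U where U: "\<And>p. p \<in> C \<Longrightarrow> openin T (U p) \<and> p \<in> U p \<and> (\<forall>\<^sub>F k in sequentially. r k \<notin> U p)"
    by metis
  have "\<exists>\<G>. finite \<G> \<and> \<G> \<subseteq> U ` C \<and> C \<subseteq> \<Union>\<G>"
    using C[unfolded compactin_def, THEN conjunct2, rule_format, of "U ` C"] U by blast
  then obtain \<G> where \<G>: "finite \<G>" "\<G> \<subseteq> U ` C" "C \<subseteq> \<Union>\<G>"
    by blast
  have "\<forall>G\<in>\<G>. \<forall>\<^sub>F k in sequentially. r k \<notin> G"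
    using \<G>(2) U by blast
  then have "\<forall>\<^sub>F k in sequentially. \<forall>G\<in>\<G>. r k \<notin> G"
    using \<G>(1) by (simp add: eventually_ball_finite)
  then have "\<exists>k. \<forall>G\<in>\<G>. r k \<notin> G"
    by (rule eventually_happens'[OF sequentially_bot])
  then show False
    using \<G>(3) r by blast
qed

lemma frequently_subseq:
  fixes s :: "nat \<Rightarrow> nat"
  assumes "strict_mono s" "\<exists>\<^sub>F k in sequentially. P (s k)"
  shows "\<exists>\<^sub>F k in sequentially. P k"
  using assms eventually_subseq[of s "\<lambda>k. \<not> P k"] unfolding frequently_def by blast

text \<open>
  If the sequence did not converge to a cluster point \<open>p\<close>, a subsequence would stay in the compact
  set \<open>C - U\<close> for a neighbourhood \<open>U\<close> of \<open>p\<close> and would have another cluster point there.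
\<close>

lemma compactin_unique_cluster_point_imp_limit:
  fixes r :: "nat \<Rightarrow> 'a"
  assumes C: "compactin T C" and r: "range r \<subseteq> C"
    and uniq: "\<And>p q. p \<in> C \<Longrightarrow> q \<in> C \<Longrightarrow>
      (\<And>U. openin T U \<Longrightarrow> p \<in> U \<Longrightarrow> \<exists>\<^sub>F k in sequentially. r k \<in> U) \<Longrightarrow>
      (\<And>U. openin T U \<Longrightarrow> q \<in> U \<Longrightarrow> \<exists>\<^sub>F k in sequentially. r k \<in> U) \<Longrightarrow> p = q"
  obtains l where "l \<in> C" "limitin T r l sequentially"
proof -
  obtain p where p: "p \<in> C" "\<And>U. openin T U \<Longrightarrow> p \<in> U \<Longrightarrow> \<exists>\<^sub>F k in sequentially. r k \<in> U"
    using compactin_imp_cluster_point[OF C r] by metis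
  have "limitin T r p sequentially"
    unfolding limitin_def
  proof (intro conjI allI impI)
    show "p \<in> topspace T"
      using p(1) C compactin_subset_topspace by blast
    fix U assume U: "openin T U \<and> p \<in> U"
    show "\<forall>\<^sub>F k in sequentially. r k \<in> U"
    proof (rule ccontr)
      assume "\<not> (\<forall>\<^sub>F k in sequentially. r k \<in> U)"
      then obtain s :: "nat \<Rightarrow> nat" where s: "strict_mono s" "\<And>k. r (s k) \<notin> U"
        using not_eventually_sequentiallyD[of "\<lambda>k. r k \<in> U"] by metis
      have "compactin T (C \<inter> (topspace T - U))"
        using C U by (intro compact_Int_closedin) auto
      moreover have "C \<inter> (topspace T - U) = C - U"
        using C compactin_subset_topspace by blast
      ultimately have CU: "compactin T (C - U)"
        by simp
      have "range (r \<circ> s) \<subseteq> C - U"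
        using s r by auto
      then obtain q where q: "q \<in> C - U"
          "\<And>W. openin T W \<Longrightarrow> q \<in> W \<Longrightarrow> \<exists>\<^sub>F k in sequentially. (r \<circ> s) k \<in> W"
        using compactin_imp_cluster_point[OF CU] by metis
      have "\<exists>\<^sub>F k in sequentially. r k \<in> W" if "openin T W" "q \<in> W" for W
        using frequently_subseq[OF s(1), of "\<lambda>k. r k \<in> W"] q(2)[OF that] by simp
      then have "p = q"
        using uniq p q(1) by blast
      then show False
        using q(1) U by blast
    qed
  qed
  with p(1) that show thesis by blast
qed

text \<open>
  Pigeonhole principle for one \<open>\<phi> n\<close>, and a diagonal subsequence for all of them.
\<close>

lemma eventually_constant_subsequence:
  fixes \<phi> :: "nat \<Rightarrow> 'a \<Rightarrow> 'c" and r :: "nat \<Rightarrow> 'a"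
  assumes fin: "\<And>n. finite (\<phi> n ` C)" and r: "range r \<subseteq> C"
  shows "\<exists>s :: nat \<Rightarrow> nat. strict_mono s \<and> (\<forall>n. \<exists>c. \<forall>\<^sub>F k in sequentially. \<phi> n (r (s k)) = c)"
proof -
  interpret subseqs "\<lambda>n s. \<exists>c. \<forall>\<^sub>F k in sequentially. \<phi> n (r (s k)) = c"
  proof
    fix n and s :: "nat \<Rightarrow> nat"
    assume "strict_mono s"
    have "range (\<lambda>k. \<phi> n (r (s k))) \<subseteq> \<phi> n ` C"
      using r by auto
    then have "finite (range (\<lambda>k. \<phi> n (r (s k))))"
      using fin finite_subset by blast
    then obtain a where "infinite {k. \<phi> n (r (s k)) = \<phi> n (r (s a))}"
      using pigeonhole_infinite[of "UNIV :: nat set" "\<lambda>k. \<phi> n (r (s k))"] by auto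
    then obtain r' :: "nat \<Rightarrow> nat" where "strict_mono r'" "\<And>k. r' k \<in> {k. \<phi> n (r (s k)) = \<phi> n (r (s a))}"
      using infinite_enumerate by blast
    then show "\<exists>r'. strict_mono r' \<and> (\<exists>c. \<forall>\<^sub>F k in sequentially. \<phi> n (r ((s \<circ> r') k)) = c)"
      by (intro exI[of _ r'] conjI exI[of _ "\<phi> n (r (s a))"]) auto
  qed
  have "\<exists>c. \<forall>\<^sub>F k in sequentially. \<phi> n (r (diagseq k)) = c" for n
  proof -
    have "\<exists>c. \<forall>\<^sub>F k in sequentially. \<phi> n (r ((diagseq \<circ> (+) (Suc n)) k)) = c"
    proof (rule diagseq_holds)
      fix t s m
      assume t: "strict_mono (t :: nat \<Rightarrow> nat)" and "\<exists>c. \<forall>\<^sub>F k in sequentially. \<phi> m (r (s k)) = c"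
      then obtain c where "\<forall>\<^sub>F k in sequentially. \<phi> m (r (s k)) = c"
        by blast
      from eventually_subseq[OF t this] show "\<exists>c. \<forall>\<^sub>F k in sequentially. \<phi> m (r ((s \<circ> t) k)) = c"
        by auto
    qed
    then obtain c where "\<forall>\<^sub>F k in sequentially. \<phi> n (r (diagseq (k + Suc n))) = c"
      by (auto simp: add.commute)
    then show ?thesis
      using eventually_sequentially_seg[of "\<lambda>k. \<phi> n (r (diagseq k)) = c" "Suc n"] by blast
  qed
  then show ?thesis
    using subseq_diagseq by blast
qed

text \<open>
  Along a subsequence on which all the data are eventually constant, two distinct cluster points
  are impossible: the subsequence would visit both of their separating neighbourhoods with equal
  data. This replaces a proof that \<open>C\<close> is metrizable.
\<close>

lemma compactin_separated_imp_seq_compactin: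
  fixes \<phi> :: "nat \<Rightarrow> 'a \<Rightarrow> 'c"
  assumes C: "compactin T C" and fin: "\<And>n. finite (\<phi> n ` C)"
    and sep: "\<And>p q. p \<in> C \<Longrightarrow> q \<in> C \<Longrightarrow> p \<noteq> q \<Longrightarrow>
      \<exists>n U V. openin T U \<and> openin T V \<and> p \<in> U \<and> q \<in> V \<and> (\<forall>u\<in>U \<inter> C. \<forall>v\<in>V \<inter> C. \<phi> n u \<noteq> \<phi> n v)"
  shows "seq_compactin T C"
  unfolding seq_compactin_def
proof (intro conjI allI impI)
  show "C \<subseteq> topspace T"
    using C compactin_subset_topspace by blast
  fix r :: "nat \<Rightarrow> 'a" assume r: "range r \<subseteq> C"
  obtain s :: "nat \<Rightarrow> nat" where s: "strict_mono s" "\<forall>n. \<exists>c. \<forall>\<^sub>F k in sequentially. \<phi> n (r (s k)) = c"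
    using eventually_constant_subsequence[of \<phi> C r, OF fin r] by blast
  have rs: "range (r \<circ> s) \<subseteq> C"
    using r by auto
  have "\<exists>l. l \<in> C \<and> limitin T (r \<circ> s) l sequentially"
  proof (rule compactin_unique_cluster_point_imp_limit[OF C rs])
    fix p q
    assume p: "p \<in> C" and q: "q \<in> C"
      and clp: "\<And>U. openin T U \<Longrightarrow> p \<in> U \<Longrightarrow> \<exists>\<^sub>F k in sequentially. (r \<circ> s) k \<in> U"
      and clq: "\<And>U. openin T U \<Longrightarrow> q \<in> U \<Longrightarrow> \<exists>\<^sub>F k in sequentially. (r \<circ> s) k \<in> U"
    show "p = q"
    proof (rule ccontr)
      assume "p \<noteq> q"
      then obtain n U V where UV: "openin T U" "openin T V" "p \<in> U" "q \<in> V"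
          and ne: "\<And>u v. u \<in> U \<inter> C \<Longrightarrow> v \<in> V \<inter> C \<Longrightarrow> \<phi> n u \<noteq> \<phi> n v"
        using sep p q by metis
      obtain c where c: "\<forall>\<^sub>F k in sequentially. \<phi> n (r (s k)) = c"
        using s(2) by blast
      have "\<exists>k. (r \<circ> s) k \<in> W \<and> \<phi> n (r (s k)) = c"
        if "\<exists>\<^sub>F k in sequentially. (r \<circ> s) k \<in> W" for W
        using frequently_eventually_conj[OF that c] frequently_ex by fastforce
      then obtain i j where "(r \<circ> s) i \<in> U" "\<phi> n (r (s i)) = c" "(r \<circ> s) j \<in> V" "\<phi> n (r (s j)) = c"
        using clp clq UV by metis
      with ne[of "r (s i)" "r (s j)"] r show False by auto
    qed
  qed blast
  with s(1) show "\<exists>s l. strict_mono s \<and> l \<in> C \<and> limitin T (r \<circ> s) l sequentially"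
    by blast
qed

section \<open>Networks in \<open>\<aleph>\<close>-spaces\<close>

lemma locally_finite_in_UN:
  assumes "finite I" "\<And>i. i \<in> I \<Longrightarrow> locally_finite_in Y (\<A> i)"
  shows "locally_finite_in Y (\<Union>i\<in>I. \<A> i)"
  unfolding locally_finite_in_def
proof (intro conjI ballI)
  show "\<Union>(\<Union>i\<in>I. \<A> i) \<subseteq> topspace Y"
    using assms(2) unfolding locally_finite_in_def by blast
  fix y assume y: "y \<in> topspace Y"
  have "\<forall>i\<in>I. \<exists>V. openin Y V \<and> y \<in> V \<and> finite {A \<in> \<A> i. A \<inter> V \<noteq> {}}"
    using assms(2) y unfolding locally_finite_in_def by blast
  then obtain V where V: "\<And>i. i \<in> I \<Longrightarrow> openin Y (V i) \<and> y \<in> V i \<and> finite {A \<in> \<A> i. A \<inter> V i \<noteq> {}}"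
    by metis
  define W where "W = topspace Y \<inter> (\<Inter>i\<in>I. V i)"
  have "openin Y W"
    unfolding W_def using assms(1) V by (intro openin_Int_Inter) auto
  moreover have "y \<in> W"
    using V y by (auto simp: W_def)
  moreover have "{A \<in> (\<Union>i\<in>I. \<A> i). A \<inter> W \<noteq> {}} \<subseteq> (\<Union>i\<in>I. {A \<in> \<A> i. A \<inter> V i \<noteq> {}})"
    by (fastforce simp: W_def)
  then have "finite {A \<in> (\<Union>i\<in>I. \<A> i). A \<inter> W \<noteq> {}}"
    by (rule finite_subset) (use assms(1) V in auto)
  ultimately show "\<exists>V. openin Y V \<and> y \<in> V \<and> finite {A \<in> (\<Union>i\<in>I. \<A> i). A \<inter> V \<noteq> {}}"
    by blast
qed

lemma locally_finite_in_compactin: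
  assumes "locally_finite_in Y \<A>" "compactin Y C"
  shows "finite {A \<in> \<A>. A \<inter> C \<noteq> {}}"
proof -
  have "\<forall>y\<in>C. \<exists>V. openin Y V \<and> y \<in> V \<and> finite {A \<in> \<A>. A \<inter> V \<noteq> {}}"
    using assms compactin_subset_topspace unfolding locally_finite_in_def by blast
  then obtain V where V: "\<And>y. y \<in> C \<Longrightarrow> openin Y (V y) \<and> y \<in> V y \<and> finite {A \<in> \<A>. A \<inter> V y \<noteq> {}}"
    by metis
  have "\<exists>\<V>. finite \<V> \<and> \<V> \<subseteq> V ` C \<and> C \<subseteq> \<Union>\<V>"
    using assms(2)[unfolded compactin_def, THEN conjunct2, rule_format, of "V ` C"] V by blast
  then obtain \<V> where \<V>: "finite \<V>" "\<V> \<subseteq> V ` C" "C \<subseteq> \<Union>\<V>"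
    by blast
  have "{A \<in> \<A>. A \<inter> C \<noteq> {}} \<subseteq> (\<Union>W\<in>\<V>. {A \<in> \<A>. A \<inter> W \<noteq> {}})"
    using \<V>(3) by blast
  then show ?thesis
    by (rule finite_subset) (use \<V> V in auto)
qed

text \<open>
  A \<open>\<sigma>\<close>-locally finite \<open>k\<close>-network with closed members. A finite cover is required to come from a
  single one of the families, as the constructions below treat one locally finite family at a
  time.
\<close>

definition closed_k_networks :: "'b topology \<Rightarrow> (nat \<Rightarrow> 'b set set) \<Rightarrow> bool"
  where "closed_k_networks Y \<P> \<longleftrightarrow>
    (\<forall>n. locally_finite_in Y (\<P> n)) \<and> (\<forall>n. \<forall>P\<in>\<P> n. closedin Y P) \<and>
    (\<forall>U K. openin Y U \<and> compactin Y K \<and> K \<subseteq> U \<longrightarrow>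
       (\<exists>n \<H>. finite \<H> \<and> \<H> \<subseteq> \<P> n \<and> K \<subseteq> \<Union>\<H> \<and> \<Union>\<H> \<subseteq> U))"

lemma closed_k_networksD:
  assumes "closed_k_networks Y \<P>"
  shows "locally_finite_in Y (\<P> n)" "P \<in> \<P> n \<Longrightarrow> closedin Y P"
    "openin Y U \<Longrightarrow> compactin Y K \<Longrightarrow> K \<subseteq> U \<Longrightarrow>
       \<exists>n \<H>. finite \<H> \<and> \<H> \<subseteq> \<P> n \<and> K \<subseteq> \<Union>\<H> \<and> \<Union>\<H> \<subseteq> U"
  using assms unfolding closed_k_networks_def by simp_all

text \<open>
  A \<open>\<sigma>\<close>-locally finite \<open>cs\<close>-network: in contrast to a \<open>k\<close>-network, one member has to contain both the
  limit and a tail of the sequence.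
\<close>

definition cs_networks :: "'b topology \<Rightarrow> (nat \<Rightarrow> 'b set set) \<Rightarrow> bool"
  where "cs_networks Y \<E> \<longleftrightarrow>
    (\<forall>n. locally_finite_in Y (\<E> n)) \<and>
    (\<forall>U r y. openin Y U \<and> y \<in> U \<and> limitin Y r y sequentially \<longrightarrow>
       (\<exists>n. \<exists>E\<in>\<E> n. y \<in> E \<and> E \<subseteq> U \<and> (\<forall>\<^sub>F k in sequentially. r k \<in> E)))"

text \<open>
  These are the data that \<open>compactin_separated_imp_seq_compactin\<close> asks for, for all compact sets
  at once.
\<close>

definition separating_data :: "'b topology \<Rightarrow> (nat \<Rightarrow> 'b \<Rightarrow> 'c) \<Rightarrow> bool"
  where "separating_data Y c \<longleftrightarrow>
    (\<forall>C. compactin Y C \<longrightarrow> (\<forall>n. finite (c n ` C)) \<and>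
      (\<forall>p\<in>C. \<forall>q\<in>C. p \<noteq> q \<longrightarrow> (\<exists>n U V. openin Y U \<and> openin Y V \<and> p \<in> U \<and> q \<in> V \<and>
         (\<forall>u\<in>U \<inter> C. \<forall>v\<in>V \<inter> C. c n u \<noteq> c n v))))"

text \<open>
  Regularity lets a compact \<open>K \<subseteq> U\<close> be covered inside an open \<open>V\<close> with closure in \<open>U\<close>, so the closures
  of the members of a \<open>k\<close>-network form a \<open>k\<close>-network again. Taking the union of the first \<open>n\<close> families
  makes them increase, so that finitely many members lie in one of them.
\<close>

lemma aleph_space_closed_networks:
  fixes Y :: "'b topology"
  assumes "aleph_space Y"
  obtains \<P> where "closed_k_networks Y \<P>"
proof -
  obtain \<A> :: "nat \<Rightarrow> 'b set set" where \<A>: "\<And>n. locally_finite_in Y (\<A> n)" "k_network Y (\<Union>n. \<A> n)"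
    and reg: "regular_space Y"
    using assms unfolding aleph_space_def sigma_locally_finite_in_def by blast
  define \<P> where "\<P> n = (\<Union>i\<le>n. (\<lambda>S. Y closure_of S) ` \<A> i)" for n
  have net: "\<exists>n \<H>. finite \<H> \<and> \<H> \<subseteq> \<P> n \<and> K \<subseteq> \<Union>\<H> \<and> \<Union>\<H> \<subseteq> U"
    if U: "openin Y U" and K: "compactin Y K" and KU: "K \<subseteq> U" for U K
  proof -
    have "closedin Y (topspace Y - U)" "disjnt K (topspace Y - U)"
      using U KU by (auto simp: disjnt_def)
    then obtain V W where VW: "openin Y V" "openin Y W" "K \<subseteq> V" "topspace Y - U \<subseteq> W" "disjnt V W"
      using regular_space_compact_closed_separation[OF reg K] by metis
    have "V \<subseteq> topspace Y - W"
      using VW openin_subset by (fastforce simp: disjnt_iff)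
    then have clV: "Y closure_of V \<subseteq> U"
      using closure_of_minimal[of V "topspace Y - W" Y] VW(2,4) by blast
    obtain \<H> where \<H>: "finite \<H>" "\<H> \<subseteq> (\<Union>n. \<A> n)" "K \<subseteq> \<Union>\<H>" "\<Union>\<H> \<subseteq> V"
      using \<A>(2) VW(1,3) K unfolding k_network_def by metis
    have "\<forall>S\<in>\<H>. \<exists>n. S \<in> \<A> n"
      using \<H>(2) by blast
    then obtain \<nu> where \<nu>: "\<And>S. S \<in> \<H> \<Longrightarrow> S \<in> \<A> (\<nu> S)"
      by metis
    define n where "n = Max (\<nu> ` \<H>)"
    have "\<nu> S \<le> n" if "S \<in> \<H>" for S
      using that \<H>(1) by (simp add: n_def)
    then have 1: "(\<lambda>S. Y closure_of S) ` \<H> \<subseteq> \<P> n"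
      using \<nu> unfolding \<P>_def by blast
    have "S \<subseteq> Y closure_of S" if "S \<in> \<H>" for S
      using that \<nu>[OF that] \<A>(1)[of "\<nu> S"] unfolding locally_finite_in_def by (intro closure_of_subset) blast
    then have 2: "K \<subseteq> \<Union>((\<lambda>S. Y closure_of S) ` \<H>)"
      using \<H>(3) by blast
    have "Y closure_of S \<subseteq> U" if "S \<in> \<H>" for S
      using closure_of_mono[of S V Y] clV \<H>(4) that by blast
    then have "\<Union>((\<lambda>S. Y closure_of S) ` \<H>) \<subseteq> U"
      by blast
    with 1 2 \<H>(1) show ?thesis
      by (meson finite_imageI)
  qed
  have "locally_finite_in Y (\<P> n)" for n
    unfolding \<P>_def by (intro locally_finite_in_UN locally_finite_in_closure \<A>(1)) auto
  moreover have "closedin Y P" if "P \<in> \<P> n" for n P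
    using that unfolding \<P>_def by auto
  ultimately have "closed_k_networks Y \<P>"
    unfolding closed_k_networks_def by (auto intro!: net)
  then show thesis
    by (rule that)
qed

text \<open>
  The members of a finite closed cover that miss the limit contain only finitely many terms, so
  they can be dropped: all members of the cover may be assumed to contain the limit.
\<close>

lemma convergent_sequence_closed_cover:
  assumes \<P>: "closed_k_networks Y \<P>"
    and r: "limitin Y r y sequentially" and U: "openin Y U" "y \<in> U"
  obtains n \<H> where "finite \<H>" "\<H> \<subseteq> \<P> n" "\<H> \<noteq> {}" "y \<in> \<Inter>\<H>" "\<Union>\<H> \<subseteq> U"
    "\<forall>\<^sub>F k in sequentially. r k \<in> \<Union>\<H>"
proof -
  obtain m where m: "\<And>k. k \<ge> m \<Longrightarrow> r k \<in> U"
    using r U unfolding limitin_def eventually_sequentially by blast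
  have "r ` {m..} \<subseteq> topspace Y"
    using m openin_subset[OF U(1)] by auto
  then have "compactin Y (insert y (r ` {m..}))"
    using compactin_sequence_with_limit[OF r, of "r ` {m..}"] by blast
  moreover have "insert y (r ` {m..}) \<subseteq> U"
    using m U by auto
  ultimately obtain n \<G> where \<G>: "finite \<G>" "\<G> \<subseteq> \<P> n" "insert y (r ` {m..}) \<subseteq> \<Union>\<G>" "\<Union>\<G> \<subseteq> U"
    using closed_k_networksD(3)[OF \<P> U(1)] by metis
  have "\<forall>P\<in>{P \<in> \<G>. y \<notin> P}. \<forall>\<^sub>F k in sequentially. r k \<notin> P"
  proof
    fix P assume P: "P \<in> {P \<in> \<G>. y \<notin> P}"
    then have "openin Y (topspace Y - P)"
      using closed_k_networksD(2)[OF \<P>] \<G>(2) by blast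
    moreover have "y \<in> topspace Y - P"
      using P r unfolding limitin_def by blast
    ultimately have "\<forall>\<^sub>F k in sequentially. r k \<in> topspace Y - P"
      using r unfolding limitin_def by blast
    then show "\<forall>\<^sub>F k in sequentially. r k \<notin> P"
      by (rule eventually_mono) blast
  qed
  then have "\<forall>\<^sub>F k in sequentially. \<forall>P\<in>{P \<in> \<G>. y \<notin> P}. r k \<notin> P"
    using \<G>(1) by (intro eventually_ball_finite) auto
  moreover have "\<forall>\<^sub>F k in sequentially. r k \<in> \<Union>\<G>"
    unfolding eventually_sequentially using \<G>(3) by (intro exI[of _ m]) auto
  ultimately have "\<forall>\<^sub>F k in sequentially. r k \<in> \<Union>{P \<in> \<G>. y \<in> P}"
    by eventually_elim blast
  moreover have "{P \<in> \<G>. y \<in> P} \<noteq> {}"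
    using \<G>(3) by blast
  ultimately show thesis
    using \<G> by (intro that[of "{P \<in> \<G>. y \<in> P}" n]) auto
qed

text \<open>
  The natural candidates for a \<open>cs\<close>-network are the unions \<open>\<Union>\<H>\<close> of finite subfamilies \<open>\<H>\<close> of \<open>\<P>\<^sub>n\<close> with a
  common point, but they need not form a locally finite family, because a fixed \<open>P\<close> can belong to
  infinitely many \<open>\<H>\<close>. Hence \<open>\<Union>\<H>\<close> is cut down to the part covered by those \<open>Q \<in> \<P>\<^sub>m\<close> that meet \<open>\<Inter>\<H>\<close> and
  meet only finitely many members of \<open>\<P>\<^sub>n\<close>: a small neighbourhood meets finitely many such \<open>Q\<close>, and
  every member of \<open>\<H>\<close> meets \<open>Q\<close>, which leaves finitely many possible \<open>\<H>\<close>. Every convergent sequence is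
  still caught, as its limit has a neighbourhood that meets finitely many members of \<open>\<P>\<^sub>n\<close>, and the
  sets \<open>Q\<close> can be chosen inside it.
\<close>

lemma aleph_space_cs_networks:
  fixes Y :: "'b topology"
  assumes "aleph_space Y"
  obtains \<E> where "cs_networks Y \<E>"
proof -
  obtain \<P> where \<P>: "closed_k_networks Y \<P>"
    using aleph_space_closed_networks[OF assms] .
  then have lf: "\<And>n. locally_finite_in Y (\<P> n)"
    by (rule closed_k_networksD)
  define \<Q> where "\<Q> n m = {Q \<in> \<P> m. finite {P \<in> \<P> n. P \<inter> Q \<noteq> {}}}" for n m
  define E where "E n m \<H> = \<Union>\<H> \<inter> \<Union>{Q \<in> \<Q> n m. Q \<inter> \<Inter>\<H> \<noteq> {}}" for n m and \<H> :: "'b set set"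
  define \<E> where "\<E> n m = E n m ` {\<H>. \<H> \<subseteq> \<P> n \<and> \<H> \<noteq> {}}" for n m
  have \<E>_lf: "locally_finite_in Y (\<E> n m)" for n m
    unfolding locally_finite_in_def
  proof (intro conjI ballI)
    show "\<Union>(\<E> n m) \<subseteq> topspace Y"
      using lf[of n] unfolding \<E>_def E_def locally_finite_in_def by blast
    fix y assume "y \<in> topspace Y"
    then obtain V where V: "openin Y V" "y \<in> V" "finite {Q \<in> \<P> m. Q \<inter> V \<noteq> {}}"
      using lf[of m] unfolding locally_finite_in_def by blast
    define \<S> where "\<S> = (\<Union>Q\<in>{Q \<in> \<Q> n m. Q \<inter> V \<noteq> {}}. {P \<in> \<P> n. P \<inter> Q \<noteq> {}})"
    have "finite {Q \<in> \<Q> n m. Q \<inter> V \<noteq> {}}"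
      by (rule finite_subset[OF _ V(3)]) (auto simp: \<Q>_def)
    then have "finite \<S>"
      unfolding \<S>_def by (rule finite_UN_I) (auto simp: \<Q>_def)
    moreover have "{S \<in> \<E> n m. S \<inter> V \<noteq> {}} \<subseteq> E n m ` Pow \<S>"
    proof
      fix S assume "S \<in> {S \<in> \<E> n m. S \<inter> V \<noteq> {}}"
      then obtain \<H> where \<H>: "\<H> \<subseteq> \<P> n" "S = E n m \<H>" "E n m \<H> \<inter> V \<noteq> {}"
        unfolding \<E>_def by blast
      then obtain Q where "Q \<in> \<Q> n m" "Q \<inter> \<Inter>\<H> \<noteq> {}" "Q \<inter> V \<noteq> {}"
        unfolding E_def by blast
      then have "\<H> \<subseteq> \<S>"
        using \<H>(1) unfolding \<S>_def by blast
      with \<H>(2) show "S \<in> E n m ` Pow \<S>" by blast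
    qed
    ultimately have "finite {S \<in> \<E> n m. S \<inter> V \<noteq> {}}"
      using finite_subset by blast
    with V show "\<exists>V. openin Y V \<and> y \<in> V \<and> finite {S \<in> \<E> n m. S \<inter> V \<noteq> {}}"
      by blast
  qed
  have cs: "\<exists>n m S. S \<in> \<E> n m \<and> y \<in> S \<and> S \<subseteq> U \<and> (\<forall>\<^sub>F k in sequentially. r k \<in> S)"
    if U: "openin Y U" "y \<in> U" and r: "limitin Y r y sequentially" for U r y
  proof -
    obtain n \<H> where \<H>: "finite \<H>" "\<H> \<subseteq> \<P> n" "\<H> \<noteq> {}" "y \<in> \<Inter>\<H>" "\<Union>\<H> \<subseteq> U"
        "\<forall>\<^sub>F k in sequentially. r k \<in> \<Union>\<H>"
      using convergent_sequence_closed_cover[OF \<P> r U] by metis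
    have "y \<in> topspace Y"
      using r unfolding limitin_def by blast
    then obtain V where V: "openin Y V" "y \<in> V" "finite {P \<in> \<P> n. P \<inter> V \<noteq> {}}"
      using lf[of n] unfolding locally_finite_in_def by blast
    obtain m \<J> where \<J>: "finite \<J>" "\<J> \<subseteq> \<P> m" "\<J> \<noteq> {}" "y \<in> \<Inter>\<J>" "\<Union>\<J> \<subseteq> V"
        "\<forall>\<^sub>F k in sequentially. r k \<in> \<Union>\<J>"
      using convergent_sequence_closed_cover[OF \<P> r V(1,2)] by metis
    have "finite {P \<in> \<P> n. P \<inter> Q \<noteq> {}}" if "Q \<in> \<J>" for Q
      by (rule finite_subset[OF _ V(3)]) (use that \<J>(5) in blast)
    then have sub: "\<J> \<subseteq> {Q \<in> \<Q> n m. Q \<inter> \<Inter>\<H> \<noteq> {}}"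
      using \<J>(2,4) \<H>(4) unfolding \<Q>_def by blast
    have "\<forall>\<^sub>F k in sequentially. r k \<in> E n m \<H>"
      using \<H>(6) \<J>(6)
    proof eventually_elim
      case (elim k)
      then show ?case using sub unfolding E_def by blast
    qed
    moreover have "y \<in> E n m \<H>"
      using sub \<H>(3,4) \<J>(3,4) unfolding E_def by blast
    moreover have "E n m \<H> \<subseteq> U"
      using \<H>(5) unfolding E_def by blast
    moreover have "E n m \<H> \<in> \<E> n m"
      using \<H>(2,3) unfolding \<E>_def by blast
    ultimately show ?thesis
      by blast
  qed
  have "cs_networks Y (\<lambda>i. \<E> (fst (prod_decode i)) (snd (prod_decode i)))"
    unfolding cs_networks_def
  proof (intro conjI allI impI)
    show "locally_finite_in Y (\<E> (fst (prod_decode i)) (snd (prod_decode i)))" for i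
      by (rule \<E>_lf)
    fix U r y
    assume "openin Y U \<and> y \<in> U \<and> limitin Y r y sequentially"
    then obtain n m S where "S \<in> \<E> n m" "y \<in> S" "S \<subseteq> U" "\<forall>\<^sub>F k in sequentially. r k \<in> S"
      using cs by metis
    then show "\<exists>i. \<exists>S\<in>\<E> (fst (prod_decode i)) (snd (prod_decode i)). y \<in> S \<and> S \<subseteq> U \<and>
        (\<forall>\<^sub>F k in sequentially. r k \<in> S)"
      by (intro exI[of _ "prod_encode (n, m)"] bexI[of _ S]) auto
  qed
  then show thesis
    by (rule that)
qed

text \<open>
  The data of \<open>y\<close> at stage \<open>n\<close> are the members of the \<open>n\<close>-th family containing \<open>y\<close>. If \<open>p \<in> W \<subseteq> F \<subseteq> U\<close>
  with \<open>W\<close> open, \<open>F\<close> closed and \<open>U\<close> disjoint from a neighbourhood \<open>V\<close> of \<open>q\<close>, then finitely many members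
  inside \<open>U\<close> cover the compact set \<open>C \<inter> F\<close>, and they distinguish the points of \<open>W \<inter> C\<close> from those of
  \<open>V\<close>.
\<close>

lemma aleph_space_separating_data:
  fixes Y :: "'b topology"
  assumes Y: "aleph_space Y"
  obtains c :: "nat \<Rightarrow> 'b \<Rightarrow> 'b set set" where "separating_data Y c"
proof -
  obtain \<P> where \<P>: "closed_k_networks Y \<P>"
    using aleph_space_closed_networks[OF assms] .
  then have lf: "\<And>n. locally_finite_in Y (\<P> n)"
    by (rule closed_k_networksD)
  define c where "c n y = {P \<in> \<P> n. y \<in> P}" for n y
  have "separating_data Y c"
    unfolding separating_data_def
  proof (intro allI impI conjI ballI)
    fix n C assume C: "compactin Y C"
    have "c n ` C \<subseteq> Pow {P \<in> \<P> n. P \<inter> C \<noteq> {}}"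
      unfolding c_def by blast
    then show "finite (c n ` C)"
      by (rule finite_subset) (use locally_finite_in_compactin[OF lf C] in simp)
  next
    fix C p q assume C: "compactin Y C" and pq: "p \<in> C" "q \<in> C" "p \<noteq> q"
    have tY: "p \<in> topspace Y" "q \<in> topspace Y"
      using C pq compactin_subset_topspace by blast+
    then obtain U V where UV: "openin Y U" "openin Y V" "p \<in> U" "q \<in> V" "disjnt U V"
      using Y pq(3) unfolding aleph_space_def Hausdorff_space_def by metis
    have "neighbourhood_base_of (closedin Y) Y"
      using Y unfolding aleph_space_def by (simp add: neighbourhood_base_of_closedin)
    then obtain W F where W: "openin Y W" "closedin Y F" "p \<in> W" "W \<subseteq> F" "F \<subseteq> U"
      using UV(1,3) unfolding neighbourhood_base_of by metis
    obtain n \<H> where \<H>: "finite \<H>" "\<H> \<subseteq> \<P> n" "C \<inter> F \<subseteq> \<Union>\<H>" "\<Union>\<H> \<subseteq> U"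
      using closed_k_networksD(3)[OF \<P> UV(1) compact_Int_closedin[OF C W(2)]] W(5) by (metis le_infI2)
    have "c n u \<noteq> c n v" if uv: "u \<in> W \<inter> C" "v \<in> V \<inter> C" for u v
    proof -
      obtain P where "P \<in> \<H>" "u \<in> P"
        using uv(1) W(4) \<H>(3) by blast
      moreover have "v \<notin> P"
        using uv(2) \<open>P \<in> \<H>\<close> \<H>(4) UV(5) by (auto simp: disjnt_iff)
      ultimately show ?thesis
        using \<H>(2) unfolding c_def by blast
    qed
    with UV(2,4) W(1,3) show "\<exists>n U V. openin Y U \<and> openin Y V \<and> p \<in> U \<and> q \<in> V \<and>
        (\<forall>u\<in>U \<inter> C. \<forall>v\<in>V \<inter> C. c n u \<noteq> c n v)"
      by blast
  qed
  then show thesis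
    by (rule that)
qed

lemma aleph_space_compactin_imp_seq_compactin:
  assumes "aleph_space Y" "compactin Y C"
  shows "seq_compactin Y C"
proof -
  obtain c :: "nat \<Rightarrow> 'a \<Rightarrow> 'a set set" where "separating_data Y c"
    using aleph_space_separating_data[OF assms(1)] .
  then show ?thesis
    using assms(2) compactin_separated_imp_seq_compactin[OF assms(2), of c]
    unfolding separating_data_def by blast
qed

section \<open>Countable families in \<open>\<aleph>\<^sub>0\<close>-spaces\<close>

text \<open>
  A countable family is the union of its one-element subfamilies, which are locally finite.
\<close>

lemma aleph0_imp_aleph_space:
  assumes "aleph0_space X"
  shows "aleph_space X"
proof -
  obtain \<N> where \<N>: "countable \<N>" "k_network X \<N>"
    using assms unfolding aleph0_space_def by blast
  define \<A> where "\<A> n = (if \<N> = {} then {} else {from_nat_into \<N> n})" for n :: nat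
  have eq: "\<N> = (\<Union>n. \<A> n)"
    using range_from_nat_into[OF _ \<N>(1)] unfolding \<A>_def by auto
  have "locally_finite_in X (\<A> n)" for n
  proof (rule finite_imp_locally_finite_in)
    have "\<A> n \<subseteq> \<N>"
      using eq by blast
    then show "\<Union>(\<A> n) \<subseteq> topspace X"
      using \<N>(2) unfolding k_network_def by blast
  qed (simp add: \<A>_def)
  then have "sigma_locally_finite_in X \<N>"
    unfolding sigma_locally_finite_in_def using eq by blast
  with \<N>(2) assms show ?thesis
    unfolding aleph0_space_def aleph_space_def by blast
qed

text \<open>
  This plays the role of a countable neighbourhood base at the limit of a convergent sequence:
  the sets need not be neighbourhoods of the limit, but they contain almost all terms and shrink
  to it.
\<close>

definition shrinking_family :: "'a topology \<Rightarrow> 'a set set \<Rightarrow> bool"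
  where "shrinking_family X \<N> \<longleftrightarrow> \<N> \<subseteq> Pow (topspace X) \<and>
    (\<forall>r x. limitin X r x sequentially \<longrightarrow>
       (\<exists>N :: nat \<Rightarrow> 'a set. range N \<subseteq> \<N> \<and> (\<forall>j. \<forall>\<^sub>F k in sequentially. r k \<in> N j) \<and>
          (\<forall>U. openin X U \<and> x \<in> U \<longrightarrow> (\<forall>\<^sub>F j in sequentially. N j \<subseteq> U))))"

text \<open>
  The family consists of the finite intersections of finite unions of members of a countable
  \<open>k\<close>-network. For a given sequence, the countably many finite unions that contain a tail of it
  are enumerated and intersected successively.
\<close>

lemma aleph0_space_shrinking_family:
  fixes X :: "'a topology"
  assumes "aleph0_space X"
  obtains \<N> where "countable \<N>" "\<N> \<noteq> {}" "shrinking_family X \<N>"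
proof -
  obtain \<M> where \<M>: "countable \<M>" "k_network X \<M>"
    using assms unfolding aleph0_space_def by blast
  define \<G> where "\<G> = Union ` {\<H>. finite \<H> \<and> \<H> \<subseteq> \<M>}"
  define \<N> where "\<N> = (\<lambda>\<A>. topspace X \<inter> \<Inter>\<A>) ` {\<A>. finite \<A> \<and> \<A> \<subseteq> \<G>}"
  have "countable \<G>"
    unfolding \<G>_def using \<M>(1) by (intro countable_image countable_Collect_finite_subset)
  then have "countable \<N>"
    unfolding \<N>_def by (intro countable_image countable_Collect_finite_subset)
  moreover have "\<N> \<noteq> {}" "\<N> \<subseteq> Pow (topspace X)"
    unfolding \<N>_def by auto
  moreover have "\<exists>N :: nat \<Rightarrow> 'a set. range N \<subseteq> \<N> \<and>
       (\<forall>j. \<forall>\<^sub>F k in sequentially. r k \<in> N j) \<and>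
       (\<forall>U. openin X U \<and> x \<in> U \<longrightarrow> (\<forall>\<^sub>F j in sequentially. N j \<subseteq> U))"
    if r: "limitin X r x sequentially" for r x
  proof -
    define \<G>' where "\<G>' = {G \<in> \<G>. \<forall>\<^sub>F k in sequentially. r k \<in> G}"
    have ex: "\<exists>G\<in>\<G>'. G \<subseteq> U" if U: "openin X U" "x \<in> U" for U
    proof -
      obtain m where m: "\<And>k. k \<ge> m \<Longrightarrow> r k \<in> U"
        using r U unfolding limitin_def eventually_sequentially by blast
      have "r ` {m..} \<subseteq> topspace X"
        using m openin_subset[OF U(1)] by auto
      then have "compactin X (insert x (r ` {m..}))"
        using compactin_sequence_with_limit[OF r, of "r ` {m..}"] by blast
      moreover have "insert x (r ` {m..}) \<subseteq> U"
        using m U by auto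
      ultimately obtain \<H> where \<H>: "finite \<H>" "\<H> \<subseteq> \<M>" "insert x (r ` {m..}) \<subseteq> \<Union>\<H>" "\<Union>\<H> \<subseteq> U"
        using \<M>(2) U(1) unfolding k_network_def by metis
      have "\<forall>\<^sub>F k in sequentially. r k \<in> \<Union>\<H>"
        unfolding eventually_sequentially using \<H>(3) by (intro exI[of _ m]) auto
      then have "\<Union>\<H> \<in> \<G>'"
        unfolding \<G>'_def \<G>_def using \<H>(1,2) by blast
      with \<H>(4) show ?thesis by blast
    qed
    have xX: "x \<in> topspace X"
      using r unfolding limitin_def by blast
    have "\<G>' \<noteq> {}"
      using ex[OF openin_topspace xX] by blast
    have cG: "countable \<G>'"
      using \<open>countable \<G>\<close> unfolding \<G>'_def by (rule countable_subset[rotated]) auto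
    define G where "G = from_nat_into \<G>'"
    have G: "range G = \<G>'"
      unfolding G_def using \<open>\<G>' \<noteq> {}\<close> cG by (rule range_from_nat_into)
    define N where "N j = topspace X \<inter> \<Inter>(G ` {..j})" for j :: nat
    have "range N \<subseteq> \<N>"
    proof
      fix S assume "S \<in> range N"
      then obtain j where "S = topspace X \<inter> \<Inter>(G ` {..j})"
        unfolding N_def by blast
      moreover have "G ` {..j} \<subseteq> \<G>"
        using G unfolding \<G>'_def by blast
      ultimately show "S \<in> \<N>"
        unfolding \<N>_def by blast
    qed
    moreover have "\<forall>\<^sub>F k in sequentially. r k \<in> N j" for j
    proof -
      have "\<forall>i\<in>{..j}. \<forall>\<^sub>F k in sequentially. r k \<in> G i"
        using G unfolding \<G>'_def by blast
      then have "\<forall>\<^sub>F k in sequentially. \<forall>i\<in>{..j}. r k \<in> G i"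
        by (intro eventually_ball_finite) auto
      moreover have "\<forall>\<^sub>F k in sequentially. r k \<in> topspace X"
        using r xX unfolding limitin_def by blast
      ultimately show ?thesis
        by eventually_elim (auto simp: N_def)
    qed
    moreover have "\<forall>\<^sub>F j in sequentially. N j \<subseteq> U" if U: "openin X U" "x \<in> U" for U
    proof -
      obtain i where "G i \<subseteq> U"
        using ex[OF U] G by blast
      then show ?thesis
        unfolding eventually_sequentially N_def by (intro exI[of _ i]) auto
    qed
    ultimately show ?thesis
      by blast
  qed
  ultimately show thesis
    using that unfolding shrinking_family_def by simp
qed

text \<open>
  Choose a point of \<open>S\<close> in every member of a countable network that meets \<open>S\<close>.
\<close>

lemma aleph0_space_countable_dense_subset:
  fixes X :: "'a topology"
  assumes X: "aleph0_space X" and S: "S \<subseteq> topspace X"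
  obtains D where "countable D" "D \<subseteq> S" "S \<subseteq> X closure_of D"
proof -
  obtain \<N> where \<N>: "countable \<N>" "k_network X \<N>"
    using X unfolding aleph0_space_def by blast
  define D where "D = (\<lambda>N. SOME d. d \<in> N \<inter> S) ` {N \<in> \<N>. N \<inter> S \<noteq> {}}"
  have D: "(SOME d. d \<in> N \<inter> S) \<in> N \<inter> S" if "N \<inter> S \<noteq> {}" for N
    using that by (metis ex_in_conv someI_ex)
  have "countable D"
    unfolding D_def by (intro countable_image) (use \<N>(1) in auto)
  moreover have "D \<subseteq> S"
    unfolding D_def using D by blast
  moreover have "S \<subseteq> X closure_of D"
  proof
    fix x assume x: "x \<in> S"
    show "x \<in> X closure_of D"
      unfolding in_closure_of
    proof (intro conjI allI impI)
      show xX: "x \<in> topspace X"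
        using x S by blast
      fix U assume U: "x \<in> U \<and> openin X U"
      have "compactin X {x}"
        using xX by simp
      then obtain \<H> where \<H>: "\<H> \<subseteq> \<N>" "{x} \<subseteq> \<Union>\<H>" "\<Union>\<H> \<subseteq> U"
        using \<N>(2) U unfolding k_network_def by (metis empty_subsetI insert_subset)
      obtain N where N: "N \<in> \<H>" "x \<in> N"
        using \<H>(2) by auto
      then have N: "N \<in> \<N>" "x \<in> N" "N \<subseteq> U"
        using \<H> by auto
      then have "N \<inter> S \<noteq> {}"
        using x by blast
      with D[OF this] N show "\<exists>y. y \<in> D \<and> y \<in> U"
        unfolding D_def by blast
    qed
  qed
  ultimately show thesis
    by (rule that)
qed

section \<open>A criterion for \<open>k\<^sup>*\<close>-metrizability\<close>

lemma openin_product_discrete_cylinder: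
  fixes \<sigma> :: "nat \<Rightarrow> 'c"
  shows "openin (product_topology (\<lambda>_. discrete_topology UNIV) UNIV) {\<tau>. \<forall>j\<le>i. \<tau> j = \<sigma> j}"
    (is "openin ?P _")
proof -
  have "openin ?P {\<tau> \<in> topspace ?P. \<tau> j \<in> {\<sigma> j}}" for j
    by (rule openin_continuous_map_preimage[OF continuous_map_product_projection]) auto
  then have "openin ?P (\<Inter>j\<in>{..i}. {\<tau> \<in> topspace ?P. \<tau> j \<in> {\<sigma> j}})"
    by (intro openin_INT2) auto
  moreover have "(\<Inter>j\<in>{..i}. {\<tau> \<in> topspace ?P. \<tau> j \<in> {\<sigma> j}}) = {\<tau>. \<forall>j\<le>i. \<tau> j = \<sigma> j}"
    by auto
  ultimately show ?thesis
    by simp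
qed

text \<open>
  Here \<open>P\<close> is the countable product of discrete spaces of data, \<open>conv \<sigma> l\<close> says that \<open>\<sigma>\<close> is the limit
  of the data of a sequence converging to \<open>l\<close>, and \<open>M\<close> is the subspace of those \<open>\<sigma>\<close> that have such an
  \<open>l\<close>. The set of the data of single points serves as the \<open>Z\<close> in the definition of a subproper map.
\<close>

proposition kstar_metrizable_spaceI_discrete_data:
  fixes T :: "'a topology" and b :: "nat \<Rightarrow> 'a \<Rightarrow> 'c"
  assumes H: "Hausdorff_space T" and reg: "regular_space T"
    and sc: "\<And>C. compactin T C \<Longrightarrow> seq_compactin T C"
    and fin: "\<And>C i. compactin T C \<Longrightarrow> finite (b i ` C)"
    and lim: "\<And>f g l. range f \<subseteq> topspace T \<Longrightarrow> range g \<subseteq> topspace T \<Longrightarrow> limitin T g l sequentially \<Longrightarrow>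
      (\<And>i. \<forall>\<^sub>F k in sequentially. b i (f k) = b i (g k)) \<Longrightarrow> limitin T f l sequentially"
  shows "kstar_metrizable_space T"
proof -
  define P :: "(nat \<Rightarrow> 'c) topology" where "P = product_topology (\<lambda>_. discrete_topology UNIV) UNIV"
  have tP: "topspace P = UNIV"
    by (simp add: P_def)
  have cylinder: "openin P {\<tau>. \<forall>j\<le>i. \<tau> j = \<sigma> j}" for i \<sigma>
    unfolding P_def by (rule openin_product_discrete_cylinder)
  define conv where "conv \<sigma> l \<longleftrightarrow> (\<exists>g. range g \<subseteq> topspace T \<and> limitin T g l sequentially \<and>
      (\<forall>i. \<forall>\<^sub>F k in sequentially. b i (g k) = \<sigma> i))" for \<sigma> l
  have conv_unique: "l = l'" if l: "conv \<sigma> l" and l': "conv \<sigma> l'" for \<sigma> l l'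
  proof -
    obtain g where g: "range g \<subseteq> topspace T" "limitin T g l sequentially"
        "\<And>i. \<forall>\<^sub>F k in sequentially. b i (g k) = \<sigma> i"
      using l unfolding conv_def by auto
    obtain g' where g': "range g' \<subseteq> topspace T" "limitin T g' l' sequentially"
        "\<And>i. \<forall>\<^sub>F k in sequentially. b i (g' k) = \<sigma> i"
      using l' unfolding conv_def by auto
    have "\<forall>\<^sub>F k in sequentially. b i (g k) = b i (g' k)" for i
      using g(3)[of i] g'(3)[of i] by eventually_elim simp
    then have "limitin T g l' sequentially"
      by (rule lim[OF g(1) g'(1,2)])
    then show ?thesis
      using limitin_Hausdorff_unique[OF g(2) _ _ H] by auto
  qed
  define A where "A = {\<sigma>. \<exists>l. conv \<sigma> l}"
  define M where "M = subtopology P A"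
  have tM: "topspace M = A"
    by (simp add: M_def tP)
  define \<pi> where "\<pi> \<sigma> = (THE l. conv \<sigma> l)" for \<sigma>
  have \<pi>: "\<pi> \<sigma> = l" if "conv \<sigma> l" for \<sigma> l
    unfolding \<pi>_def using that conv_unique by (intro the_equality) auto
  define B where "B x = (\<lambda>i. b i x)" for x
  have conv_B: "conv (B x) x" if "x \<in> topspace T" for x
    unfolding conv_def B_def using that by (intro exI[of _ "\<lambda>_. x"]) auto
  have BA: "B ` topspace T \<subseteq> A"
    unfolding A_def using conv_B by blast
  have contm: "continuous_map M T \<pi>"
    unfolding continuous_map_def
  proof (intro conjI allI impI)
    show "\<pi> \<in> topspace M \<rightarrow> topspace T"
    proof
      fix \<sigma> assume "\<sigma> \<in> topspace M"
      then obtain l where l: "conv \<sigma> l"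
        unfolding tM A_def by blast
      then have "l \<in> topspace T"
        unfolding conv_def limitin_def by blast
      then show "\<pi> \<sigma> \<in> topspace T"
        using \<pi>[OF l] by simp
    qed
    fix U assume U: "openin T U"
    show "openin M {\<sigma> \<in> topspace M. \<pi> \<sigma> \<in> U}"
      unfolding openin_subopen[of M "{\<sigma> \<in> topspace M. \<pi> \<sigma> \<in> U}"]
    proof
      fix \<sigma> assume \<sigma>: "\<sigma> \<in> {\<sigma> \<in> topspace M. \<pi> \<sigma> \<in> U}"
      then obtain l where l: "conv \<sigma> l"
        unfolding tM A_def by blast
      then have lU: "l \<in> U"
        using \<pi>[OF l] \<sigma> by simp
      obtain g where g: "range g \<subseteq> topspace T" "limitin T g l sequentially"
          "\<And>i. \<forall>\<^sub>F k in sequentially. b i (g k) = \<sigma> i"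
        using l unfolding conv_def by auto
      obtain V F where V: "openin T V" "closedin T F" "l \<in> V" "V \<subseteq> F" "F \<subseteq> U"
        using reg U lU unfolding neighbourhood_base_of_closedin[symmetric] neighbourhood_base_of by metis
      \<comment> \<open>finitely many data already force a point into \<open>V\<close>; otherwise a sequence outside \<open>V\<close>
        would have the same data as \<open>g\<close>\<close>
      have "\<exists>i. \<forall>h\<in>topspace T. (\<forall>j\<le>i. b j h = \<sigma> j) \<longrightarrow> h \<in> V"
      proof (rule ccontr)
        assume "\<not> ?thesis"
        then have "\<forall>i. \<exists>h. h \<in> topspace T \<and> (\<forall>j\<le>i. b j h = \<sigma> j) \<and> h \<notin> V"
          by blast
        then obtain h where h: "\<And>i. h i \<in> topspace T" "\<And>i j. j \<le> i \<Longrightarrow> b j (h i) = \<sigma> j" "\<And>i. h i \<notin> V"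
          by metis
        have "\<forall>\<^sub>F k in sequentially. b j (h k) = b j (g k)" for j
          using g(3)[of j] eventually_ge_at_top[of j] by eventually_elim (simp add: h(2))
        then have "limitin T h l sequentially"
          using h(1) by (intro lim[OF _ g(1,2)]) auto
        then have "\<forall>\<^sub>F k in sequentially. h k \<in> V"
          using V unfolding limitin_def by blast
        then show False
          using h(3) by simp
      qed
      then obtain i where i: "\<And>h. h \<in> topspace T \<Longrightarrow> (\<And>j. j \<le> i \<Longrightarrow> b j h = \<sigma> j) \<Longrightarrow> h \<in> V"
        by blast
      \<comment> \<open>the points of this cylinder are limits of data of sequences that are eventually in
        \<open>V \<subseteq> F\<close>, and \<open>F\<close> is closed\<close>
      define W where "W = {\<tau>. \<forall>j\<le>i. \<tau> j = \<sigma> j} \<inter> A"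
      have "openin M W"
        unfolding M_def W_def by (rule openin_subtopology_Int[OF cylinder])
      moreover have "\<sigma> \<in> W"
        using \<sigma> unfolding W_def tM by blast
      moreover have "W \<subseteq> {\<sigma> \<in> topspace M. \<pi> \<sigma> \<in> U}"
      proof
        fix \<tau> assume \<tau>: "\<tau> \<in> W"
        then obtain l' where l': "conv \<tau> l'"
          unfolding W_def A_def by blast
        obtain g' where g': "range g' \<subseteq> topspace T" "limitin T g' l' sequentially"
            "\<And>i. \<forall>\<^sub>F k in sequentially. b i (g' k) = \<tau> i"
          using l' unfolding conv_def by auto
        have "\<forall>\<^sub>F k in sequentially. \<forall>j\<in>{..i}. b j (g' k) = \<tau> j"
          using g'(3) by (intro eventually_ball_finite) auto
        then have "\<forall>\<^sub>F k in sequentially. g' k \<in> F"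
        proof eventually_elim
          case (elim k)
          then have "b j (g' k) = \<sigma> j" if "j \<le> i" for j
            using that \<tau> unfolding W_def by simp
          then show ?case
            using i[of "g' k"] g'(1) V(4) by auto
        qed
        then have "l' \<in> F"
          by (rule limitin_closedin[OF g'(2) V(2)]) simp
        then show "\<tau> \<in> {\<sigma> \<in> topspace M. \<pi> \<sigma> \<in> U}"
          using \<tau> \<pi>[OF l'] V(5) unfolding W_def tM by auto
      qed
      ultimately show "\<exists>W. openin M W \<and> \<sigma> \<in> W \<and> W \<subseteq> {\<sigma> \<in> topspace M. \<pi> \<sigma> \<in> U}"
        by blast
    qed
  qed
  have metr: "metrizable_space M"
    unfolding M_def P_def
    by (intro metrizable_space_subtopology) (simp add: metrizable_space_product_topology)
  have pre: "precompact_in M (B ` topspace T \<inter> \<pi> -` K)" if K: "precompact_in T K" for K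
  proof -
    define C where "C = T closure_of K"
    have C: "compactin T C" and KT: "K \<subseteq> topspace T"
      using K unfolding precompact_in_def C_def by auto
    have KC: "K \<subseteq> C"
      unfolding C_def by (rule closure_of_subset[OF KT])
    have CT: "C \<subseteq> topspace T"
      using C compactin_subset_topspace by blast
    define Q where "Q = P closure_of (B ` C)"
    \<comment> \<open>the data of \<open>C\<close> lie in this box, which is compact as its factors are finite\<close>
    define \<Phi> where "\<Phi> = PiE UNIV (\<lambda>i. b i ` C)"
    have "compactin P \<Phi>"
      unfolding P_def \<Phi>_def using fin[OF C] by (simp add: compactin_PiE compactin_discrete_topology)
    moreover have "closedin P \<Phi>"
      unfolding P_def \<Phi>_def by (simp add: closedin_product_topology)
    moreover have "B ` C \<subseteq> \<Phi>"
      unfolding B_def \<Phi>_def by auto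
    ultimately have "compactin P Q"
      unfolding Q_def by (meson closed_compactin closedin_closure_of closure_of_minimal)
    \<comment> \<open>the closure \<open>Q\<close> in \<open>P\<close> does not leave \<open>M\<close>: a sequence in \<open>C\<close> whose data tend to \<open>\<sigma>\<close> has a
      convergent subsequence\<close>
    moreover have QA: "Q \<subseteq> A"
    proof
      fix \<sigma> assume \<sigma>: "\<sigma> \<in> Q"
      have "\<exists>x. x \<in> C \<and> (\<forall>j\<le>i. b j x = \<sigma> j)" for i
      proof -
        have "\<exists>\<tau>. \<tau> \<in> B ` C \<and> \<tau> \<in> {\<tau>. \<forall>j\<le>i. \<tau> j = \<sigma> j}"
          by (rule \<sigma>[unfolded Q_def in_closure_of, THEN conjunct2, rule_format]) (simp add: cylinder)
        then show ?thesis
          unfolding B_def by blast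
      qed
      then obtain x where x: "\<And>i. x i \<in> C" "\<And>i j. j \<le> i \<Longrightarrow> b j (x i) = \<sigma> j"
        by metis
      have "range x \<subseteq> C"
        using x(1) by blast
      then obtain s l where s: "strict_mono s" "limitin T (x \<circ> s) l sequentially"
        by (rule seq_compactinE[OF sc[OF C]])
      have "\<forall>\<^sub>F k in sequentially. b j (x k) = \<sigma> j" for j
        using eventually_ge_at_top[of j] by eventually_elim (simp add: x(2))
      then have "\<forall>\<^sub>F k in sequentially. b j ((x \<circ> s) k) = \<sigma> j" for j
        using eventually_subseq[OF s(1), of "\<lambda>k. b j (x k) = \<sigma> j"] by simp
      moreover have "range (x \<circ> s) \<subseteq> topspace T"
        using x(1) CT by auto
      ultimately have "conv \<sigma> l"
        unfolding conv_def using s(2) by blast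
      then show "\<sigma> \<in> A"
        unfolding A_def by blast
    qed
    ultimately have QM: "compactin M Q"
      unfolding M_def by (simp add: compactin_subtopology)
    define S where "S = B ` topspace T \<inter> \<pi> -` K"
    have "S \<subseteq> B ` C"
    proof
      fix \<sigma> assume "\<sigma> \<in> S"
      then obtain x where "x \<in> topspace T" "\<sigma> = B x" "\<pi> (B x) \<in> K"
        unfolding S_def by blast
      then show "\<sigma> \<in> B ` C"
        using \<pi>[OF conv_B] KC by auto
    qed
    then have "M closure_of S \<subseteq> Q"
      using closure_of_mono[of S "B ` C" P] unfolding M_def Q_def closure_of_subtopology
      by (metis (no_types, lifting) closure_of_mono inf.coboundedI2 inf_le2 order_trans)
    then have "compactin M (M closure_of S)"
      using QM closed_compactin closedin_closure_of by metis
    moreover have "S \<subseteq> topspace M"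
      using BA unfolding S_def tM by blast
    ultimately show ?thesis
      unfolding precompact_in_def S_def by blast
  qed
  have "subproper_map M T \<pi>"
    unfolding subproper_map_def
  proof (intro conjI exI[of _ "B ` topspace T"] allI impI)
    show "continuous_map M T \<pi>"
      by (rule contm)
    show "B ` topspace T \<subseteq> topspace M"
      using BA tM by simp
    show "\<pi> ` B ` topspace T = topspace T"
      using \<pi>[OF conv_B] by (auto simp: image_image)
  qed (rule pre)
  then show ?thesis
    using kstar_metrizable_spaceI[OF H metr] by blast
qed

section \<open>The topology of \<open>C\<^sub>\<K>(X,Y)\<close>\<close>

text \<open>
  With a name for the subbasic sets \<open>[F,U]\<close>, finite families of them can be quantified over
  without the sets \<open>K\<close>, \<open>F\<close>, \<open>U\<close> that represent them.
\<close>

definition C_subbasic :: "'a set set \<Rightarrow> 'a topology \<Rightarrow> 'b topology \<Rightarrow> ('a \<Rightarrow> 'b) set \<Rightarrow> bool"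
  where "C_subbasic \<K> X Y S \<longleftrightarrow> (\<exists>K F U. K \<in> \<K> \<and> closedin (subtopology X K) F \<and> openin Y U \<and>
    S = {f \<in> cont_funs X Y. f ` F \<subseteq> U})"

lemma C_subbasicI:
  "K \<in> \<K> \<Longrightarrow> closedin (subtopology X K) F \<Longrightarrow> openin Y U \<Longrightarrow>
    C_subbasic \<K> X Y {f \<in> cont_funs X Y. f ` F \<subseteq> U}"
  unfolding C_subbasic_def by blast

lemma C_subbasicE:
  assumes "C_subbasic \<K> X Y S"
  obtains K F U where "K \<in> \<K>" "closedin (subtopology X K) F" "openin Y U"
    "S = {f \<in> cont_funs X Y. f ` F \<subseteq> U}"
  using assms unfolding C_subbasic_def by (elim exE conjE)

lemma C_topology_eq_subbasic:
  "C_topology \<K> X Y =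
    topology (arbitrary union_of (finite intersection_of C_subbasic \<K> X Y relative_to cont_funs X Y))"
  unfolding C_topology_def by (simp add: C_subbasic_def[abs_def])

lemma openin_C_topology_subbasic:
  assumes "K \<in> \<K>" "closedin (subtopology X K) F" "openin Y U"
  shows "openin (C_topology \<K> X Y) {f \<in> cont_funs X Y. f ` F \<subseteq> U}"
  using C_subbasicI[OF assms]
  by (auto simp: C_topology_eq_subbasic openin_subbase
        intro!: arbitrary_union_of_inc relative_to_subset_inc finite_intersection_of_inc)

lemma openin_C_topology_imp_subbasic:
  assumes "openin (C_topology \<K> X Y) W" "f \<in> W"
  shows "\<exists>\<S>. finite \<S> \<and> (\<forall>S\<in>\<S>. C_subbasic \<K> X Y S \<and> f \<in> S) \<and> cont_funs X Y \<inter> \<Inter>\<S> \<subseteq> W"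
proof -
  have "(arbitrary union_of (finite intersection_of C_subbasic \<K> X Y relative_to cont_funs X Y)) W"
    using assms(1) unfolding C_topology_eq_subbasic openin_subbase .
  then obtain V where V: "f \<in> V" "V \<subseteq> W" "(finite intersection_of C_subbasic \<K> X Y relative_to cont_funs X Y) V"
    using assms(2) unfolding union_of_def by blast
  then obtain \<S> where \<S>: "finite \<S>" "\<S> \<subseteq> Collect (C_subbasic \<K> X Y)" "V = cont_funs X Y \<inter> \<Inter>\<S>"
    unfolding relative_to_def intersection_of_def by blast
  have "\<forall>S\<in>\<S>. C_subbasic \<K> X Y S \<and> f \<in> S"
    using \<S>(2,3) V(1) by auto
  with \<S>(1,3) V(2) show ?thesis
    by auto
qed

lemma limitin_C_topologyI:
  assumes l: "l \<in> cont_funs X Y" and f: "\<forall>\<^sub>F k in G. f k \<in> cont_funs X Y"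
    and sub: "\<And>K F U. K \<in> \<K> \<Longrightarrow> closedin (subtopology X K) F \<Longrightarrow> openin Y U \<Longrightarrow> l ` F \<subseteq> U \<Longrightarrow>
      \<forall>\<^sub>F k in G. f k ` F \<subseteq> U"
  shows "limitin (C_topology \<K> X Y) f l G"
  unfolding limitin_def
proof (intro conjI allI impI)
  show "l \<in> topspace (C_topology \<K> X Y)"
    using l by simp
  fix W assume "openin (C_topology \<K> X Y) W \<and> l \<in> W"
  then obtain \<S> where \<S>: "finite \<S>" "\<forall>S\<in>\<S>. C_subbasic \<K> X Y S \<and> l \<in> S" "cont_funs X Y \<inter> \<Inter>\<S> \<subseteq> W"
    using openin_C_topology_imp_subbasic[of \<K> X Y W l] by auto
  have "\<forall>S\<in>\<S>. \<forall>\<^sub>F k in G. f k \<in> S"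
  proof
    fix S assume S: "S \<in> \<S>"
    then have "C_subbasic \<K> X Y S"
      using \<S>(2) by blast
    then obtain K F U where KFU: "K \<in> \<K>" "closedin (subtopology X K) F" "openin Y U"
        "S = {f \<in> cont_funs X Y. f ` F \<subseteq> U}"
      by (rule C_subbasicE)
    have "l \<in> S"
      using \<S>(2) S by blast
    then have "l ` F \<subseteq> U"
      by (simp add: KFU(4))
    then have "\<forall>\<^sub>F k in G. f k ` F \<subseteq> U"
      by (rule sub[OF KFU(1-3)])
    with f show "\<forall>\<^sub>F k in G. f k \<in> S"
      by eventually_elim (simp add: KFU(4))
  qed
  then have "\<forall>\<^sub>F k in G. \<forall>S\<in>\<S>. f k \<in> S"
    by (rule eventually_ball_finite[OF \<S>(1)])
  with f show "\<forall>\<^sub>F k in G. f k \<in> W"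
    by eventually_elim (use \<S>(3) in blast)
qed

lemma closedin_subtopology_compactin:
  assumes "compactin X K" "closedin (subtopology X K) F"
  shows "compactin X F"
proof -
  have "compact_space (subtopology X K)"
    using assms(1) by (rule compact_space_subtopology)
  then show ?thesis
    using closedin_compact_space[OF _ assms(2)] by (simp add: compactin_subtopology)
qed

lemma closedin_subtopology_singleton:
  assumes "Hausdorff_space X" "x \<in> topspace X" "x \<in> K"
  shows "closedin (subtopology X K) {x}"
  using assms by (intro closedin_Hausdorff_singleton Hausdorff_space_subtopology) auto

lemma continuous_map_C_topology_evaluation:
  assumes X: "Hausdorff_space X" and K: "K \<in> \<K>" "x \<in> K" "x \<in> topspace X"
  shows "continuous_map (C_topology \<K> X Y) Y (\<lambda>f. f x)"
  unfolding continuous_map_def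
proof (intro conjI allI impI)
  show "(\<lambda>f. f x) \<in> topspace (C_topology \<K> X Y) \<rightarrow> topspace Y"
    using K(3) by (auto simp: cont_funs_def continuous_map_def)
  fix U assume "openin Y U"
  then have "openin (C_topology \<K> X Y) {f \<in> cont_funs X Y. f ` {x} \<subseteq> U}"
    by (rule openin_C_topology_subbasic[OF K(1) closedin_subtopology_singleton[OF X K(3,2)]])
  then show "openin (C_topology \<K> X Y) {f \<in> topspace (C_topology \<K> X Y). f x \<in> U}"
    by simp
qed

text \<open>
  It suffices to shrink a subbasic set \<open>[F,U]\<close> around \<open>f\<close>. As \<open>f ` F\<close> is compact and \<open>Y\<close> regular, there
  are disjoint open sets \<open>V \<supseteq> f ` F\<close> and \<open>V' \<supseteq> Y - U\<close>, and \<open>[F,V] \<subseteq> [F,Y - V'] \<subseteq> [F,U]\<close>, where the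
  middle set is closed since it is cut out by conditions on the values at single points of \<open>F\<close>.
\<close>

lemma regular_space_C_topology:
  assumes X: "Hausdorff_space X" and Y: "regular_space Y" and cpt: "\<And>K. K \<in> \<K> \<Longrightarrow> compactin X K"
  shows "regular_space (C_topology \<K> X Y)"
proof -
  let ?T = "C_topology \<K> X Y"
  have "\<exists>U V. openin ?T U \<and> closedin ?T V \<and> f \<in> U \<and> U \<subseteq> V \<and> V \<subseteq> W"
    if W: "openin ?T W" "f \<in> W" for W f
  proof -
    obtain \<S> where \<S>: "finite \<S>" "\<forall>S\<in>\<S>. C_subbasic \<K> X Y S \<and> f \<in> S" "cont_funs X Y \<inter> \<Inter>\<S> \<subseteq> W"
      using openin_C_topology_imp_subbasic[OF W] by auto
    have fC: "f \<in> cont_funs X Y"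
      using openin_subset[OF W(1)] W(2) by auto
    have "\<exists>A B. openin ?T A \<and> closedin ?T B \<and> f \<in> A \<and> A \<subseteq> B \<and> B \<subseteq> S" if S: "S \<in> \<S>" for S
    proof -
      have "C_subbasic \<K> X Y S"
        using \<S>(2) S by blast
      then obtain K F U where KFU: "K \<in> \<K>" "closedin (subtopology X K) F" "openin Y U"
          "S = {f \<in> cont_funs X Y. f ` F \<subseteq> U}"
        by (rule C_subbasicE)
      have "f \<in> S"
        using \<S>(2) S by blast
      then have fU: "f ` F \<subseteq> U"
        by (simp add: KFU(4))
      have FK: "F \<subseteq> K" "F \<subseteq> topspace X"
        using closedin_subset[OF KFU(2)] by auto
      have "compactin Y (f ` F)"
        using closedin_subtopology_compactin[OF cpt[OF KFU(1)] KFU(2)] fC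
        by (auto simp: cont_funs_def intro: image_compactin)
      moreover have "closedin Y (topspace Y - U)"
        using KFU(3) by blast
      moreover have "disjnt (f ` F) (topspace Y - U)"
        using fU by (auto simp: disjnt_def)
      ultimately obtain V V' where V: "openin Y V" "openin Y V'" "f ` F \<subseteq> V" "topspace Y - U \<subseteq> V'" "disjnt V V'"
        using regular_space_compact_closed_separation[OF Y] by metis
      define A where "A = {f \<in> cont_funs X Y. f ` F \<subseteq> V}"
      define B where "B = {f \<in> cont_funs X Y. f ` F \<subseteq> topspace Y - V'}"
      have "openin ?T A"
        unfolding A_def by (rule openin_C_topology_subbasic[OF KFU(1,2) V(1)])
      moreover have "closedin ?T B"
      proof -
        have YF: "h x \<in> topspace Y" if "h \<in> cont_funs X Y" "x \<in> F" for h x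
          using that FK(2) unfolding cont_funs_def continuous_map_def by blast
        have "openin ?T {h \<in> cont_funs X Y. h ` {x} \<subseteq> V'}" if "x \<in> F" for x
          using that FK by (intro openin_C_topology_subbasic[OF KFU(1) _ V(2)] closedin_subtopology_singleton[OF X]) auto
        then have "openin ?T (\<Union>x\<in>F. {h \<in> cont_funs X Y. h ` {x} \<subseteq> V'})"
          by blast
        moreover have "(\<Union>x\<in>F. {h \<in> cont_funs X Y. h ` {x} \<subseteq> V'}) = topspace ?T - B"
          using YF unfolding B_def by auto
        ultimately show ?thesis
          unfolding closedin_def B_def by auto
      qed
      moreover have "f \<in> A"
        using V(3) fC unfolding A_def by blast
      moreover have "A \<subseteq> B"
        using V(5) openin_subset[OF V(1)] unfolding A_def B_def by (fastforce simp: disjnt_iff)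
      moreover have "B \<subseteq> S"
        using V(4) unfolding B_def KFU(4) by blast
      ultimately show ?thesis
        by blast
    qed
    then obtain A B where AB: "\<And>S. S \<in> \<S> \<Longrightarrow> openin ?T (A S) \<and> closedin ?T (B S) \<and> f \<in> A S \<and> A S \<subseteq> B S \<and> B S \<subseteq> S"
      by metis
    have 1: "openin ?T (topspace ?T \<inter> \<Inter>(A ` \<S>))"
      using AB \<S>(1) by (intro openin_Int_Inter openin_topspace) auto
    have "closedin ?T (\<Inter>(insert (topspace ?T) (B ` \<S>)))"
      using AB closedin_topspace[of ?T] by (intro closedin_Inter) (auto simp del: topspace_C_topology)
    then have 2: "closedin ?T (topspace ?T \<inter> \<Inter>(B ` \<S>))"
      by (simp del: topspace_C_topology)
    have 3: "f \<in> topspace ?T \<inter> \<Inter>(A ` \<S>)"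
      using AB fC by auto
    have 4: "topspace ?T \<inter> \<Inter>(A ` \<S>) \<subseteq> topspace ?T \<inter> \<Inter>(B ` \<S>)"
      using AB by blast
    have "B S \<subseteq> S" if "S \<in> \<S>" for S
      using AB[OF that] by simp
    then have 5: "topspace ?T \<inter> \<Inter>(B ` \<S>) \<subseteq> W"
      using \<S>(3) by fastforce
    show ?thesis
      by (intro exI conjI) (fact 1 2 3 4 5)+
  qed
  then show ?thesis
    unfolding neighbourhood_base_of_closedin[symmetric] neighbourhood_base_of by blast
qed

lemma cont_funs_eqI:
  assumes "f \<in> cont_funs X Y" "g \<in> cont_funs X Y" "Hausdorff_space Y" "topspace X \<subseteq> X closure_of D"
    "\<And>d. d \<in> D \<Longrightarrow> f d = g d"
  shows "f = g"
proof (rule extensionalityI[of _ "topspace X"])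
  show "f \<in> extensional (topspace X)" "g \<in> extensional (topspace X)"
    using assms(1,2) unfolding cont_funs_def by auto
  fix x assume "x \<in> topspace X"
  then show "f x = g x"
    using assms by (intro forall_in_closure_of_eq[of x X D Y f g]) (auto simp: cont_funs_def)
qed

lemma Hausdorff_space_C_topology:
  assumes X: "Hausdorff_space X" and Y: "Hausdorff_space Y" and dense: "X closure_of (\<Union>\<K>) = topspace X"
    and cpt: "\<And>K. K \<in> \<K> \<Longrightarrow> compactin X K"
  shows "Hausdorff_space (C_topology \<K> X Y)"
  unfolding Hausdorff_space_def
proof (intro allI impI)
  fix f g
  assume fg: "f \<in> topspace (C_topology \<K> X Y) \<and> g \<in> topspace (C_topology \<K> X Y) \<and> f \<noteq> g"
  have fg': "f \<in> cont_funs X Y" "g \<in> cont_funs X Y" "f \<noteq> g"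
    using fg by auto
  then obtain x K where x: "x \<in> K" "K \<in> \<K>" "f x \<noteq> g x"
    using cont_funs_eqI[OF fg'(1,2) Y, of "\<Union>\<K>"] dense by blast
  have xX: "x \<in> topspace X"
    using x cpt compactin_subset_topspace by blast
  have cont: "continuous_map (C_topology \<K> X Y) Y (\<lambda>f. f x)"
    using continuous_map_C_topology_evaluation[OF X x(2,1) xX] .
  have "f x \<in> topspace Y" "g x \<in> topspace Y"
    using fg' xX unfolding cont_funs_def continuous_map_def by auto
  then obtain U V where UV: "openin Y U" "openin Y V" "f x \<in> U" "g x \<in> V" "disjnt U V"
    using Y x(3) unfolding Hausdorff_space_def by metis
  have "openin (C_topology \<K> X Y) {h \<in> topspace (C_topology \<K> X Y). h x \<in> U}"
       "openin (C_topology \<K> X Y) {h \<in> topspace (C_topology \<K> X Y). h x \<in> V}"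
    using openin_continuous_map_preimage[OF cont] UV by auto
  moreover have "disjnt {h \<in> topspace (C_topology \<K> X Y). h x \<in> U} {h \<in> topspace (C_topology \<K> X Y). h x \<in> V}"
    using UV(5) by (auto simp: disjnt_iff)
  ultimately show "\<exists>U V. openin (C_topology \<K> X Y) U \<and> openin (C_topology \<K> X Y) V \<and> f \<in> U \<and> g \<in> V \<and> disjnt U V"
    using fg UV(3,4) by (intro exI conjI) auto
qed

text \<open>
  The data of \<open>f\<close> are the separating data of the values \<open>f d\<close>, where \<open>d\<close> runs through a countable
  dense subset of \<open>X\<close> contained in \<open>\<Union>\<K>\<close>. The latter makes the evaluation at \<open>d\<close> continuous, so that
  compact sets of functions have compact sets of values and neighbourhoods in \<open>Y\<close> pull back to
  open sets of functions.
\<close>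

lemma compactin_C_topology_imp_seq_compactin:
  fixes X :: "'a topology" and Y :: "'b topology"
  assumes X: "aleph0_space X" and Y: "aleph_space Y" and cpt: "\<And>K. K \<in> \<K> \<Longrightarrow> compactin X K"
    and dense: "X closure_of (\<Union>\<K>) = topspace X" and C: "compactin (C_topology \<K> X Y) C"
  shows "seq_compactin (C_topology \<K> X Y) C"
proof -
  let ?T = "C_topology \<K> X Y"
  have HX: "Hausdorff_space X" and HY: "Hausdorff_space Y"
    using X Y unfolding aleph0_space_def aleph_space_def by auto
  have KX: "\<Union>\<K> \<subseteq> topspace X"
    using cpt compactin_subset_topspace by blast
  obtain D where D: "countable D" "D \<subseteq> \<Union>\<K>" "\<Union>\<K> \<subseteq> X closure_of D"
    using aleph0_space_countable_dense_subset[OF X KX] .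
  have "X closure_of (\<Union>\<K>) \<subseteq> X closure_of D"
    by (rule closure_of_minimal[OF D(3) closedin_closure_of])
  then have Ddense: "topspace X \<subseteq> X closure_of D"
    using dense by simp
  obtain c :: "nat \<Rightarrow> 'b \<Rightarrow> 'b set set" where c: "separating_data Y c"
    using aleph_space_separating_data[OF Y] .
  have CT: "C \<subseteq> cont_funs X Y"
    using compactin_subset_topspace[OF C] by simp
  have ev: "continuous_map ?T Y (\<lambda>f. f d)" if "d \<in> D" for d
    using that D(2) KX continuous_map_C_topology_evaluation[OF HX] by blast
  have evC: "compactin Y ((\<lambda>f. f d) ` C)" if "d \<in> D" for d
    by (rule image_compactin[OF C ev[OF that]])
  define \<phi> where "\<phi> i f = (if D = {} then {}
      else c (fst (prod_decode i)) (f (from_nat_into D (snd (prod_decode i)))))" for i and f :: "'a \<Rightarrow> 'b"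
  show ?thesis
  proof (rule compactin_separated_imp_seq_compactin[where \<phi> = \<phi>, OF C])
    show "finite (\<phi> i ` C)" for i
    proof (cases "D = {}")
      case True
      then have "\<phi> i ` C \<subseteq> {{}}"
        by (auto simp: \<phi>_def)
      then show ?thesis
        by (rule finite_subset) simp
    next
      case False
      define n d where "n = fst (prod_decode i)" and "d = from_nat_into D (snd (prod_decode i))"
      have "d \<in> D"
        unfolding d_def using False by (rule from_nat_into)
      then have "finite (c n ` (\<lambda>f. f d) ` C)"
        using c evC unfolding separating_data_def by blast
      moreover have "\<phi> i ` C = c n ` (\<lambda>f. f d) ` C"
        using False unfolding \<phi>_def n_def d_def by (simp add: image_image)
      ultimately show ?thesis
        by simp
    qed
    fix f g assume fg: "f \<in> C" "g \<in> C" "f \<noteq> g"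
    then obtain d where d: "d \<in> D" "f d \<noteq> g d"
      using cont_funs_eqI[of f X Y g D] CT HY Ddense by blast
    then obtain n U V where UV: "openin Y U" "openin Y V" "f d \<in> U" "g d \<in> V"
        "\<And>u v. u \<in> U \<inter> (\<lambda>f. f d) ` C \<Longrightarrow> v \<in> V \<inter> (\<lambda>f. f d) ` C \<Longrightarrow> c n u \<noteq> c n v"
      using c[unfolded separating_data_def, rule_format, OF evC[OF d(1)], THEN conjunct2, rule_format, of "f d" "g d"]
        fg by (metis image_eqI)
    define U' V' where "U' = {h \<in> topspace ?T. h d \<in> U}" and "V' = {h \<in> topspace ?T. h d \<in> V}"
    have "openin ?T U'" "openin ?T V'"
      unfolding U'_def V'_def using openin_continuous_map_preimage[OF ev[OF d(1)]] UV by auto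
    moreover have "f \<in> U'" "g \<in> V'"
      using fg CT UV unfolding U'_def V'_def by auto
    moreover obtain j where j: "from_nat_into D j = d"
      using from_nat_into_surj[OF D(1) d(1)] by blast
    have "\<phi> (prod_encode (n, j)) u \<noteq> \<phi> (prod_encode (n, j)) v" if "u \<in> U' \<inter> C" "v \<in> V' \<inter> C" for u v
      using that d(1) UV(5)[of "u d" "v d"] unfolding \<phi>_def U'_def V'_def by (auto simp: j)
    ultimately show "\<exists>i U V. openin ?T U \<and> openin ?T V \<and> f \<in> U \<and> g \<in> V \<and>
        (\<forall>u\<in>U \<inter> C. \<forall>v\<in>V \<inter> C. \<phi> i u \<noteq> \<phi> i v)"
      by blast
  qed
qed

lemma seq_compactin_subtopology:
  assumes "seq_compactin T C" "C \<subseteq> S"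
  shows "seq_compactin (subtopology T S) C"
  unfolding seq_compactin_def
proof (intro conjI allI impI)
  show "C \<subseteq> topspace (subtopology T S)"
    using assms unfolding seq_compactin_def by auto
  fix r :: "nat \<Rightarrow> 'a" assume r: "range r \<subseteq> C"
  then obtain s l where sl: "strict_mono (s :: nat \<Rightarrow> nat)" "l \<in> C" "limitin T (r \<circ> s) l sequentially"
    by (rule seq_compactinE[OF assms(1)])
  have "r k \<in> S" for k
    using r assms(2) by auto
  then have "limitin (subtopology T S) (r \<circ> s) l sequentially"
    unfolding limitin_subtopology using sl assms(2) by auto
  with sl show "\<exists>s l. strict_mono s \<and> l \<in> C \<and> limitin (subtopology T S) (r \<circ> s) l sequentially"
    by blast
qed

section \<open>Sequentially continuous evaluation\<close>

text \<open>
  Sequential continuity only promises some limit for the image of a convergent sequence.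
  Interleaving the sequence with its limit identifies it as the value at the limit.
\<close>

lemma sequentially_continuous_map_limitin:
  assumes h: "sequentially_continuous_map A Y h" and Y: "Hausdorff_space Y"
    and s: "range s \<subseteq> topspace A" "limitin A s l sequentially"
  shows "limitin Y (h \<circ> s) (h l) sequentially"
proof -
  define t where "t k = (if even k then s (k div 2) else l)" for k :: nat
  have l: "l \<in> topspace A"
    using s(2) unfolding limitin_def by blast
  have "limitin A t l sequentially"
    unfolding limitin_def
  proof (intro conjI allI impI l)
    fix U assume U: "openin A U \<and> l \<in> U"
    then obtain n where n: "\<And>k. k \<ge> n \<Longrightarrow> s k \<in> U"
      using s(2) unfolding limitin_def eventually_sequentially by blast
    show "\<forall>\<^sub>F k in sequentially. t k \<in> U"
      unfolding eventually_sequentially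
    proof (intro exI allI impI)
      fix k assume "2 * n \<le> k"
      then have "n \<le> k div 2" by simp
      then show "t k \<in> U"
        using n U unfolding t_def by auto
    qed
  qed
  moreover have "range t \<subseteq> topspace A"
    using s(1) l unfolding t_def by auto
  ultimately obtain m where m: "limitin Y (h \<circ> t) m sequentially"
    using h unfolding sequentially_continuous_map_def by blast
  have "limitin Y ((h \<circ> t) \<circ> (\<lambda>k. 2 * k + 1)) m sequentially"
    by (rule limitin_subsequence[OF _ m]) (auto simp: strict_mono_def)
  then have "limitin Y (\<lambda>k::nat. h l) m sequentially"
    by (simp add: o_def t_def)
  moreover have "h l \<in> topspace Y"
    using h l unfolding sequentially_continuous_map_def by blast
  then have "limitin Y (\<lambda>k::nat. h l) (h l) sequentially"
    by simp
  ultimately have "m = h l"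
    using limitin_Hausdorff_unique Y sequentially_bot by metis
  moreover have "limitin Y ((h \<circ> t) \<circ> (\<lambda>k. 2 * k)) m sequentially"
    by (rule limitin_subsequence[OF _ m]) (auto simp: strict_mono_def)
  moreover have "(h \<circ> t) \<circ> (\<lambda>k. 2 * k) = h \<circ> s"
    by (auto simp: t_def)
  ultimately show ?thesis
    by simp
qed

text \<open>
  The hypothesis on the evaluation operator, stated for the two coordinate sequences and with
  the limit identified.
\<close>

definition jointly_seq_continuous_evaluation ::
    "('a \<Rightarrow> 'b) topology \<Rightarrow> 'a topology \<Rightarrow> 'b topology \<Rightarrow> bool"
  where "jointly_seq_continuous_evaluation T X Y \<longleftrightarrow>
    (\<forall>f l x a. range f \<subseteq> topspace T \<and> limitin T f l sequentially \<and>
       range x \<subseteq> topspace X \<and> limitin X x a sequentially \<longrightarrow>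
       limitin Y (\<lambda>k. f k (x k)) (l a) sequentially)"

lemma jointly_seq_continuous_evaluationD:
  assumes "jointly_seq_continuous_evaluation T X Y" "range f \<subseteq> topspace T" "limitin T f l sequentially"
    "range x \<subseteq> topspace X" "limitin X x a sequentially"
  shows "limitin Y (\<lambda>k. f k (x k)) (l a) sequentially"
  using assms unfolding jointly_seq_continuous_evaluation_def by simp

text \<open>
  Infinitely many distinct \<open>A\<^sub>k \<ni> f\<^sub>k x\<close> are impossible: along a convergent subsequence of \<open>f\<^sub>k\<close> the
  values converge, and infinitely many of the \<open>A\<^sub>k\<close> would meet every neighbourhood of the limit.
  Sequential compactness is what is needed of \<open>C\<close>, as evaluation at \<open>x\<close> is only known to be
  sequentially continuous.
\<close>

lemma finite_locally_finite_evaluation: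
  fixes T :: "('a \<Rightarrow> 'b) topology"
  assumes C: "seq_compactin T C" and lf: "locally_finite_in Y \<A>"
    and ev: "jointly_seq_continuous_evaluation T X Y" and x: "x \<in> topspace X"
  shows "finite {A \<in> \<A>. \<exists>f\<in>C. f x \<in> A}"
proof (rule ccontr)
  assume "infinite {A \<in> \<A>. \<exists>f\<in>C. f x \<in> A}"
  then obtain A :: "nat \<Rightarrow> 'b set" where A: "inj A" "range A \<subseteq> {A \<in> \<A>. \<exists>f\<in>C. f x \<in> A}"
    using infinite_countable_subset by blast
  then have "\<forall>k. \<exists>f. f \<in> C \<and> f x \<in> A k"
    by blast
  then obtain f where f: "\<And>k. f k \<in> C" "\<And>k. f k x \<in> A k"
    by metis
  have "range f \<subseteq> C"
    using f(1) by blast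
  then obtain s l where s: "strict_mono (s :: nat \<Rightarrow> nat)" "limitin T (f \<circ> s) l sequentially"
    by (rule seq_compactinE[OF C])
  have "range (f \<circ> s) \<subseteq> topspace T"
    using f(1) C unfolding seq_compactin_def by auto
  from jointly_seq_continuous_evaluationD[OF ev this s(2), of "\<lambda>_. x" x]
  have lim: "limitin Y (\<lambda>k. f (s k) x) (l x) sequentially"
    using x by simp
  then obtain V where V: "openin Y V" "l x \<in> V" "finite {A \<in> \<A>. A \<inter> V \<noteq> {}}"
    using lf unfolding locally_finite_in_def limitin_def by blast
  then obtain m where m: "\<And>k. k \<ge> m \<Longrightarrow> f (s k) x \<in> V"
    using lim unfolding limitin_def eventually_sequentially by blast
  have "A (s k) \<in> {A \<in> \<A>. A \<inter> V \<noteq> {}}" if "k \<ge> m" for k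
    using A(2) m[OF that] f(2)[of "s k"] by blast
  then have "(A \<circ> s) ` {m..} \<subseteq> {A \<in> \<A>. A \<inter> V \<noteq> {}}"
    by auto
  then have "finite ((A \<circ> s) ` {m..})"
    using V(3) finite_subset by blast
  moreover have "inj (A \<circ> s)"
    using A(1) strict_mono_imp_inj_on[OF s(1)] by (rule inj_compose)
  ultimately have "finite {m..}"
    by (meson finite_imageD inj_on_subset subset_UNIV)
  then show False
    using infinite_Ici by blast
qed

text \<open>
  Let \<open>N\<^sub>0, N\<^sub>1, \<dots>\<close> shrink to \<open>a\<close> along the sequence \<open>x\<close>, and let \<open>P\<^sub>0, P\<^sub>1, \<dots>\<close> enumerate the countably many
  members of the \<open>cs\<close>-network that contain \<open>l a\<close> and lie in \<open>U\<close>. If every inclusion \<open>g\<^sub>k ` N\<^sub>j \<subseteq> P\<^sub>i\<close>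
  failed for almost all \<open>k\<close>, there would be \<open>z\<^sub>q \<in> N\<^sub>q\<close> and \<open>\<kappa>\<^sub>q \<ge> q\<close> such that \<open>g\<^bsub>\<kappa> q\<^esub> z\<^sub>q\<close> avoids each \<open>P\<^sub>i\<close>
  for infinitely many \<open>q\<close>. But \<open>z\<^sub>q \<longlonglongrightarrow> a\<close>, so these values converge to \<open>l a\<close> and some \<open>P\<^sub>i\<close> contains almost
  all of them.
\<close>

lemma evaluation_captured_by_networks:
  fixes X :: "'a topology" and T :: "('a \<Rightarrow> 'b) topology"
  assumes \<N>: "shrinking_family X \<N>" and \<E>: "cs_networks Y \<E>"
    and ev: "jointly_seq_continuous_evaluation T X Y"
    and g: "range g \<subseteq> topspace T" "limitin T g l sequentially"
    and x: "limitin X x a sequentially" and U: "openin Y U" "l a \<in> U"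
  shows "\<exists>N\<in>\<N>. \<exists>n. \<exists>E\<in>\<E> n. E \<subseteq> U \<and> (\<forall>\<^sub>F k in sequentially. x k \<in> N) \<and>
    (\<exists>\<^sub>F k in sequentially. g k ` N \<subseteq> E)"
proof -
  have cs: "\<exists>n. \<exists>E\<in>\<E> n. l a \<in> E \<and> E \<subseteq> U \<and> (\<forall>\<^sub>F k in sequentially. r k \<in> E)"
    if "limitin Y r (l a) sequentially" for r
    using \<E> U that unfolding cs_networks_def by metis
  have laY: "l a \<in> topspace Y"
    using openin_subset[OF U(1)] U(2) by blast
  obtain N :: "nat \<Rightarrow> 'a set" where N: "range N \<subseteq> \<N>" "\<And>j. \<forall>\<^sub>F k in sequentially. x k \<in> N j"
      "\<And>V. openin X V \<Longrightarrow> a \<in> V \<Longrightarrow> \<forall>\<^sub>F j in sequentially. N j \<subseteq> V"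
    using \<N> x unfolding shrinking_family_def by metis
  define \<A> where "\<A> = (\<Union>n. {E \<in> \<E> n. l a \<in> E \<and> E \<subseteq> U})"
  have "finite {E \<in> \<E> n. l a \<in> E \<and> E \<subseteq> U}" for n
  proof -
    have "finite {E \<in> \<E> n. E \<inter> {l a} \<noteq> {}}"
      using \<E> laY unfolding cs_networks_def by (intro locally_finite_in_compactin) auto
    then show ?thesis
      by (rule rev_finite_subset) auto
  qed
  then have "countable \<A>"
    unfolding \<A>_def by (intro countable_UN) (auto intro: countable_finite)
  moreover have "limitin Y (\<lambda>k::nat. l a) (l a) sequentially"
    using laY by simp
  from cs[OF this] have "\<A> \<noteq> {}"
    unfolding \<A>_def by blast
  ultimately have P: "range (from_nat_into \<A>) = \<A>"
    by (simp add: range_from_nat_into)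
  define P where "P = from_nat_into \<A>"
  have "\<exists>i j. \<exists>\<^sub>F k in sequentially. g k ` N j \<subseteq> P i"
  proof (rule ccontr)
    assume "\<not> ?thesis"
    then have ev_not: "\<forall>\<^sub>F k in sequentially. \<not> g k ` N j \<subseteq> P i" for i j
      by (simp add: not_frequently)
    \<comment> \<open>\<open>\<iota>\<close> takes every value infinitely often, so that every \<open>P i\<close> is avoided infinitely often\<close>
    define \<iota> where "\<iota> q = fst (prod_decode q)" for q
    have "\<exists>k z. k \<ge> q \<and> z \<in> N q \<and> g k z \<notin> P (\<iota> q)" for q
    proof -
      obtain m where "\<And>k. k \<ge> m \<Longrightarrow> \<not> g k ` N q \<subseteq> P (\<iota> q)"
        using ev_not[of q "\<iota> q"] unfolding eventually_sequentially by blast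
      then have "\<not> g (max m q) ` N q \<subseteq> P (\<iota> q)"
        by simp
      then show ?thesis
        by (intro exI[of _ "max m q"]) auto
    qed
    then obtain \<kappa> z where \<kappa>: "\<And>q. \<kappa> q \<ge> q" and z: "\<And>q. z q \<in> N q" "\<And>q. g (\<kappa> q) (z q) \<notin> P (\<iota> q)"
      by metis
    have "limitin X z a sequentially"
      unfolding limitin_def
    proof (intro conjI allI impI)
      show "a \<in> topspace X"
        using x unfolding limitin_def by blast
      fix V assume "openin X V \<and> a \<in> V"
      then have "\<forall>\<^sub>F j in sequentially. N j \<subseteq> V"
        using N(3) by blast
      then show "\<forall>\<^sub>F j in sequentially. z j \<in> V"
        by eventually_elim (use z(1) in blast)
    qed
    moreover have "range z \<subseteq> topspace X"
      using z(1) N(1) \<N> unfolding shrinking_family_def by blast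
    moreover have "limitin T (\<lambda>q. g (\<kappa> q)) l sequentially"
      unfolding limitin_def
    proof (intro conjI allI impI)
      show "l \<in> topspace T"
        using g(2) unfolding limitin_def by blast
      fix W assume "openin T W \<and> l \<in> W"
      then obtain m where "\<And>k. k \<ge> m \<Longrightarrow> g k \<in> W"
        using g(2) unfolding limitin_def eventually_sequentially by blast
      then show "\<forall>\<^sub>F q in sequentially. g (\<kappa> q) \<in> W"
        unfolding eventually_sequentially using \<kappa> by (meson order_trans)
    qed
    moreover have "range (\<lambda>q. g (\<kappa> q)) \<subseteq> topspace T"
      using g(1) by blast
    ultimately have "limitin Y (\<lambda>q. g (\<kappa> q) (z q)) (l a) sequentially"
      by (intro jointly_seq_continuous_evaluationD[OF ev])
    then obtain n E where E: "E \<in> \<E> n" "l a \<in> E" "E \<subseteq> U" "\<forall>\<^sub>F q in sequentially. g (\<kappa> q) (z q) \<in> E"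
      using cs by metis
    then have "E \<in> \<A>"
      unfolding \<A>_def by blast
    then obtain i where i: "E = P i"
      using P unfolding P_def by blast
    obtain m where "\<And>q. q \<ge> m \<Longrightarrow> g (\<kappa> q) (z q) \<in> E"
      using E(4) unfolding eventually_sequentially by blast
    then have "g (\<kappa> (prod_encode (i, m))) (z (prod_encode (i, m))) \<in> E"
      by (simp add: le_prod_encode_2)
    with z(2)[of "prod_encode (i, m)"] show False
      by (simp add: i \<iota>_def)
  qed
  then obtain i j where ij: "\<exists>\<^sub>F k in sequentially. g k ` N j \<subseteq> P i"
    by blast
  have "P i \<in> \<A>"
    using P unfolding P_def by blast
  then obtain n where n: "P i \<in> \<E> n" "P i \<subseteq> U"
    unfolding \<A>_def by blast
  have "N j \<in> \<N>"
    using N(1) by blast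
  then show ?thesis
    using n N(2)[of j] ij by (intro bexI[of _ "N j"] exI[of _ n] bexI[of _ "P i"] conjI)
qed

section \<open>\<open>k\<^sup>*\<close>-metrizability of function spaces\<close>

theorem theorem8p2:
  fixes X :: "'a topology" and Y :: "'b topology"
    and \<K> :: "'a set set" and \<F> :: "('a \<Rightarrow> 'b) set"
  assumes "aleph0_space X"
    and "aleph_space Y"
    and "\<And>K. K \<in> \<K> \<Longrightarrow> compactin X K"
    and "X closure_of (\<Union>\<K>) = topspace X"
    and "\<F> \<subseteq> cont_funs X Y"
    and "sequentially_continuous_map
           (prod_topology (subtopology (C_topology \<K> X Y) \<F>) X) Y (\<lambda>(f, x). f x)"
  shows "kstar_metrizable_space (subtopology (C_topology \<K> X Y) \<F>)"
proof -
  let ?T = "subtopology (C_topology \<K> X Y) \<F>"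
  have HX: "Hausdorff_space X" and HY: "Hausdorff_space Y" and RY: "regular_space Y"
    using assms(1,2) unfolding aleph0_space_def aleph_space_def by auto
  have tT: "topspace ?T = \<F>"
    using assms(5) by auto
  have ev: "jointly_seq_continuous_evaluation ?T X Y"
    unfolding jointly_seq_continuous_evaluation_def
  proof (intro allI impI, elim conjE)
    fix f l x a
    assume f: "range f \<subseteq> topspace ?T" "limitin ?T f l sequentially"
      and x: "range x \<subseteq> topspace X" "limitin X x a sequentially"
    have "range (\<lambda>k. (f k, x k)) \<subseteq> topspace (prod_topology ?T X)"
      using f(1) x(1) by auto
    moreover have "limitin (prod_topology ?T X) (\<lambda>k. (f k, x k)) (l, a) sequentially"
      using f(2) x(2) by (simp add: limitin_pairwise o_def)
    ultimately have "limitin Y ((\<lambda>(f, x). f x) \<circ> (\<lambda>k. (f k, x k))) (l a) sequentially"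
      using sequentially_continuous_map_limitin[OF assms(6) HY, of "\<lambda>k. (f k, x k)" "(l, a)"] by simp
    then show "limitin Y (\<lambda>k. f k (x k)) (l a) sequentially"
      by (simp add: o_def)
  qed
  have sc: "seq_compactin ?T C" if "compactin ?T C" for C
  proof -
    have "compactin (C_topology \<K> X Y) C" "C \<subseteq> \<F>"
      using that by (auto simp: compactin_subtopology)
    then show ?thesis
      using compactin_C_topology_imp_seq_compactin[OF assms(1-4)] by (intro seq_compactin_subtopology) auto
  qed
  obtain \<N> where \<N>: "countable \<N>" "\<N> \<noteq> {}" "shrinking_family X \<N>"
    using aleph0_space_shrinking_family[OF assms(1)] .
  obtain \<E> where \<E>: "cs_networks Y \<E>"
    using aleph_space_cs_networks[OF assms(2)] .
  define b where "b i f = {E \<in> \<E> (snd (prod_decode i)). f ` from_nat_into \<N> (fst (prod_decode i)) \<subseteq> E}"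
    for i and f :: "'a \<Rightarrow> 'b"
  show ?thesis
  proof (rule kstar_metrizable_spaceI_discrete_data[where b = b])
    show "Hausdorff_space ?T"
      by (intro Hausdorff_space_subtopology Hausdorff_space_C_topology HX HY assms(3,4))
    show "regular_space ?T"
      by (intro regular_space_subtopology regular_space_C_topology HX RY assms(3))
    show "seq_compactin ?T C" if "compactin ?T C" for C
      using that by (rule sc)
    show "finite (b i ` C)" if C: "compactin ?T C" for C i
    proof -
      define n N where "n = snd (prod_decode i)" and "N = from_nat_into \<N> (fst (prod_decode i))"
      have bi: "b i f = {E \<in> \<E> n. f ` N \<subseteq> E}" for f
        unfolding b_def n_def N_def ..
      have "N \<subseteq> topspace X"
        using \<N>(3) from_nat_into[OF \<N>(2)] unfolding N_def shrinking_family_def by blast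
      show ?thesis
      proof (cases "N = {}")
        case True
        then have "b i ` C \<subseteq> {\<E> n}"
          by (auto simp: bi)
        then show ?thesis
          by (rule finite_subset) simp
      next
        case False
        then obtain x where x: "x \<in> N" "x \<in> topspace X"
          using \<open>N \<subseteq> topspace X\<close> by blast
        have lf: "locally_finite_in Y (\<E> n)"
          using \<E> unfolding cs_networks_def by simp
        have "finite {E \<in> \<E> n. \<exists>f\<in>C. f x \<in> E}"
          by (rule finite_locally_finite_evaluation[OF sc[OF C] lf ev x(2)])
        moreover have "b i ` C \<subseteq> Pow {E \<in> \<E> n. \<exists>f\<in>C. f x \<in> E}"
          using x(1) unfolding bi by blast
        ultimately show ?thesis
          by (simp add: finite_subset)
      qed
    qed
    fix f g :: "nat \<Rightarrow> 'a \<Rightarrow> 'b" and l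
    assume f: "range f \<subseteq> topspace ?T" and g: "range g \<subseteq> topspace ?T" and gl: "limitin ?T g l sequentially"
      and fg: "\<And>i. \<forall>\<^sub>F k in sequentially. b i (f k) = b i (g k)"
    have l: "l \<in> \<F>"
      using gl tT unfolding limitin_def by blast
    have fF: "f k \<in> \<F>" for k
      using f tT by blast
    have "limitin (C_topology \<K> X Y) f l sequentially"
    proof (rule limitin_C_topologyI)
      show "l \<in> cont_funs X Y"
        using l assms(5) by blast
      show "\<forall>\<^sub>F k in sequentially. f k \<in> cont_funs X Y"
        using fF assms(5) by (auto intro: always_eventually)
      fix K F U
      assume K: "K \<in> \<K>" "closedin (subtopology X K) F" and U: "openin Y U" "l ` F \<subseteq> U"
      show "\<forall>\<^sub>F k in sequentially. f k ` F \<subseteq> U"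
      proof (rule ccontr)
        assume "\<not> ?thesis"
        then obtain s :: "nat \<Rightarrow> nat" where s: "strict_mono s" "\<And>k. \<not> f (s k) ` F \<subseteq> U"
          using not_eventually_sequentiallyD[of "\<lambda>k. f k ` F \<subseteq> U"] by metis
        then have "\<forall>k. \<exists>x. x \<in> F \<and> f (s k) x \<notin> U"
          by blast
        then obtain x where x: "\<And>k. x k \<in> F" "\<And>k. f (s k) (x k) \<notin> U"
          by metis
        have F: "compactin X F"
          by (rule closedin_subtopology_compactin[OF assms(3)[OF K(1)] K(2)])
        \<comment> \<open>points \<open>x k \<in> F\<close> that witness the failure have a subsequence converging in \<open>F\<close>\<close>
        have "seq_compactin X F"
          by (rule aleph_space_compactin_imp_seq_compactin[OF aleph0_imp_aleph_space[OF assms(1)] F])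
        moreover have "range x \<subseteq> F"
          using x(1) by blast
        ultimately obtain t a where t: "strict_mono (t :: nat \<Rightarrow> nat)" "a \<in> F" "limitin X (x \<circ> t) a sequentially"
          by (rule seq_compactinE)
        have st: "strict_mono (s \<circ> t)"
          using s(1) t(1) by (rule strict_mono_o)
        have "range (g \<circ> (s \<circ> t)) \<subseteq> topspace ?T"
          using g by auto
        moreover have "limitin ?T (g \<circ> (s \<circ> t)) l sequentially"
          by (rule limitin_subsequence[OF st gl])
        moreover have "l a \<in> U"
          using U(2) t(2) by blast
        ultimately obtain N n E where N: "N \<in> \<N>" and E: "E \<in> \<E> n" "E \<subseteq> U"
            and xN: "\<forall>\<^sub>F k in sequentially. (x \<circ> t) k \<in> N"
            and gN: "\<exists>\<^sub>F k in sequentially. (g \<circ> (s \<circ> t)) k ` N \<subseteq> E"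
          using evaluation_captured_by_networks[OF \<N>(3) \<E> ev _ _ t(3) U(1)] by blast
        obtain j where j: "from_nat_into \<N> j = N"
          using from_nat_into_surj[OF \<N>(1) N] by blast
        define i where "i = prod_encode (j, n)"
        have bi: "b i h = {E \<in> \<E> n. h ` N \<subseteq> E}" for h
          unfolding b_def i_def by (simp add: j)
        have "\<forall>\<^sub>F k in sequentially. b i (f ((s \<circ> t) k)) = b i (g ((s \<circ> t) k))"
          by (rule eventually_subseq[OF st fg])
        then have "\<forall>\<^sub>F k in sequentially. (x \<circ> t) k \<in> N \<and> b i (f ((s \<circ> t) k)) = b i (g ((s \<circ> t) k))"
          using xN by eventually_elim simp
        from frequently_eventually_conj[OF gN this] obtain k where
          k: "(x \<circ> t) k \<in> N" "b i (f ((s \<circ> t) k)) = b i (g ((s \<circ> t) k))" "(g \<circ> (s \<circ> t)) k ` N \<subseteq> E"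
          by (auto dest: frequently_ex)
        have "E \<in> b i (g ((s \<circ> t) k))"
          using k(3) E(1) by (simp add: bi)
        then have "E \<in> b i (f ((s \<circ> t) k))"
          using k(2) by blast
        then have "f ((s \<circ> t) k) ` N \<subseteq> E"
          by (simp add: bi)
        then show False
          using k(1) E(2) x(2)[of "t k"] by auto
      qed
    qed
    then show "limitin ?T f l sequentially"
      using l fF by (simp add: limitin_subtopology)
  qed
qed

end
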